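(* For two $\pi$-terms $\alpha$ and $\beta$ over the same finite alphabet $\Sigma$, it is decidable for all $m\in\mathbb{N}_0$ and all $Z\in\{X,Y,XY,\mathrm{WI}\}$ whether \[ [\![\alpha]\!]_{\omega+\omega^*} \equiv_m^Z [\![\beta]\!]_{\omega+\omega^*} \] holds. Furthermore, it is decidable, given $\alpha$ and $\beta$, whether \[ \forall m\in\mathbb{N}:\ [\![\alpha]\!]_{\omega+\omega^*} \equiv_m^{XY} [\![\beta]\!]_{\omega+\omega^*} \] holds.
   Context: $\mathbb{N}=\{1,2,\dots\}$, $\mathbb{N}_0=\{0,1,\dots\}$. Generalized words. A (generalized) word over $\Sigma$ is a map $w:\mathrm{dom}(w)\to\Sigma$ from a linearly ordered set (up to isomorphism). Concatenation $uv$ has domain the ordered sum. For an order type $\nu$ with underlying order $P_\nu$, $w^\nu$ has domain $\mathrm{dom}(w)\times P_\nu$ ordered by the second coordinate first, then by the first, with $(p,q)\mapsto w(p)$. $\omega+\omega^*$ is the order type of $\mathbb{N}\uplus(-\mathbb{N})$ ordered as $1,2,3,\dots\ \dots,-3,-2,-1$. $\mathrm{alph}(w)$ is the image of $w$. A word is accessible if for every position $p$ (including $p=\pm\infty$) and letter $a$: whenever there is an $a$-position strictly right of $p$ there is a smallest one, and whenever there is an $a$-position strictly left of $p$ there is a largest one. All words $[\![\gamma]\!]_{\omega+\omega^*}$ below are accessible. $\pi$-terms. $\pi$-terms over $\Sigma$: $\varepsilon$ and each $a\in\Sigma$ are $\pi$-terms; if $\alpha,\beta$ are $\pi$-terms so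 are $\alpha\beta$ and $(\alpha)^\pi$. For an order type $\mu$: $[\![\varepsilon]\!]_\mu=\varepsilon$, $[\![a]\!]_\mu=a$, $[\![\alpha\beta]\!]_\mu=[\![\alpha]\!]_\mu[\![\beta]\!]_\mu$, $[\![(\alpha)^\pi]\!]_\mu=([\![\alpha]\!]_\mu)^\mu$. Relations on accessible words. For $a\in\mathrm{alph}(w)$, $w\cdot X_a^L$, $w\cdot X_a^R$ are the factors of $w$ strictly left/right of the first $a$; $w\cdot Y_a^L$, $w\cdot Y_a^R$ those strictly left/right of the last $a$; $w\cdot C_{a,b}$ ($a,b\in\mathrm{alph}(w)$) is defined iff the first $a$-position is strictly larger than the last $b$-position, and is then the factor strictly between the last $b$ and the first $a$. $u\equiv_{m,n}^Z v$ always holds if $m=0$ or $n=0$ ($Z\in\{X,Y,\mathrm{WI}\}$). For $m,n\in\mathbb{N}$: - $u\equiv_{m,n}^X v$ iff $\mathrm{alph}(u)=\mathrm{alph}(v)$, $u\equiv_{m-1,n-1}^Y v$, and for all $a\in\mathrm{alph}(u)$: $u\cdot X_a^L\equiv_{m-1,n-1}^Y v\cdot X_a^L$ and $u\cdot X_a^R\equiv_{m,n-1}^X v\cdot X_a^R$; - $u\equiv_{m,n}^Y v$ iff $\mathrm{alph}(u)=\mathrm{alph}(v)$, $u\equiv_{m-1,n-1}^X v$, and for all $a\in\mathrm{alph}(u)$: $u\cdot Y_a^L\equiv_{m,n-1}^Y v\cdot Y_a^L$ and $u\cdot Y_a^R\equiv_{m-1,n-1}^X v\cdot Y_a^R$;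 - $u\equiv_{m,n}^{\mathrm{WI}} v$ iff $\mathrm{alph}(u)=\mathrm{alph}(v)$; for all $a\in\mathrm{alph}(u)$: $u\cdot X_a^L\equiv_{m-1,n-1}^{\mathrm{WI}} v\cdot X_a^L$, $u\cdot X_a^R\equiv_{m,n-1}^{\mathrm{WI}} v\cdot X_a^R$, $u\cdot Y_a^L\equiv_{m,n-1}^{\mathrm{WI}} v\cdot Y_a^L$, $u\cdot Y_a^R\equiv_{m-1,n-1}^{\mathrm{WI}} v\cdot Y_a^R$; and for all $a,b\in\mathrm{alph}(u)$: $u\cdot C_{a,b}$, $v\cdot C_{a,b}$ are either both undefined, or both defined with $u\cdot C_{a,b}\equiv_{m-1,n-1}^{\mathrm{WI}} v\cdot C_{a,b}$. $u\equiv_{m,n}^{XY}v$ iff $u\equiv_{m,n}^X v$ and $u\equiv_{m,n}^Y v$. For $Z\in\{X,Y,XY,\mathrm{WI}\}$, $u\equiv_m^Z v$ iff $u\equiv_{m,n}^Z v$ for all $n\in\mathbb{N}$. *)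

theory Defs
  imports Main "HOL-Library.Nat_Bijection"
begin

section \<open>Generalized words\<close>

text \<open>
  A generalized word is a reflexive linear order together with a labelling of the elements of
  its field; the values of the labelling outside the field are irrelevant. An order type is
  likewise represented by a reflexive linear order realizing it.
\<close>

record ('p, 'a) gword =
  ord :: "'p rel"
  lab :: "'p \<Rightarrow> 'a"

abbreviation positions :: "('p, 'a) gword \<Rightarrow> 'p set" where
  "positions w \<equiv> Field (ord w)"

definition alph :: "('p, 'a) gword \<Rightarrow> 'a set" where
  "alph w = lab w ` positions w"

definition gempty :: "('p, 'a) gword" where
  "gempty = \<lparr>ord = {}, lab = (\<lambda>_. undefined)\<rparr>"

definition gsingle :: "'p \<Rightarrow> 'a \<Rightarrow> ('p, 'a) gword" where
  "gsingle p a = \<lparr>ord = {(p, p)}, lab = (\<lambda>_. a)\<rparr>"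

definition gconcat :: "('p, 'a) gword \<Rightarrow> ('q, 'a) gword \<Rightarrow> ('p + 'q, 'a) gword" where
  "gconcat u v =
     \<lparr>ord = {(Inl p, Inl p') | p p'. (p, p') \<in> ord u}
          \<union> {(Inr q, Inr q') | q q'. (q, q') \<in> ord v}
          \<union> {(Inl p, Inr q) | p q. p \<in> positions u \<and> q \<in> positions v},
      lab = case_sum (lab u) (lab v)\<rparr>"

definition gpower :: "('p, 'a) gword \<Rightarrow> 'q rel \<Rightarrow> ('p \<times> 'q, 'a) gword" where
  "gpower w \<nu> =
     \<lparr>ord = {((p, q), (p', q')) | p q p' q'.
              p \<in> positions w \<and> p' \<in> positions w \<and> (q, q') \<in> \<nu> \<and>
              (q = q' \<longrightarrow> (p, p') \<in> ord w)},
      lab = (\<lambda>(p, q). lab w p)\<rparr>"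

text \<open>The isomorphic copy of a word along an injective map of positions.\<close>

definition grename :: "('p \<Rightarrow> 'q) \<Rightarrow> ('p, 'a) gword \<Rightarrow> ('q, 'a) gword" where
  "grename f w = \<lparr>ord = {(f p, f p') | p p'. (p, p') \<in> ord w}, lab = lab w \<circ> inv f\<rparr>"

definition omega_plus_omega_star :: "int rel" where
  "omega_plus_omega_star =
     {(i, j). i \<noteq> 0 \<and> j \<noteq> 0 \<and> (if 0 < i \<longleftrightarrow> 0 < j then i \<le> j else 0 < i)}"


section \<open>Terms and their interpretation\<close>

datatype (letters: 'a) pi_term =
    Eps
  | Letter 'a
  | Cat "'a pi_term" "'a pi_term"
  | Power "'a pi_term"

text \<open>
  The position type of a word denoted by a term would depend on the term. As words matter only
  up to isomorphism, all of them are transported to one type of positions, in which sums of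
  and products with \<open>'q\<close> embed.
\<close>

datatype 'q pos = Point | InL "'q pos" | InR "'q pos" | Copy "'q pos" 'q

fun interp :: "'q rel \<Rightarrow> 'a pi_term \<Rightarrow> ('q pos, 'a) gword" where
  "interp \<mu> Eps = gempty"
| "interp \<mu> (Letter a) = gsingle Point a"
| "interp \<mu> (Cat \<alpha> \<beta>) = grename (case_sum InL InR) (gconcat (interp \<mu> \<alpha>) (interp \<mu> \<beta>))"
| "interp \<mu> (Power \<alpha>) = grename (case_prod Copy) (gpower (interp \<mu> \<alpha>) \<mu>)"


section \<open>Factors\<close>

definition first_pos :: "('p, 'a) gword \<Rightarrow> 'a \<Rightarrow> 'p" where
  "first_pos w a = (THE p. p \<in> positions w \<and> lab w p = a \<and>
     (\<forall>q \<in> positions w. lab w q = a \<longrightarrow> (p, q) \<in> ord w))"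

definition last_pos :: "('p, 'a) gword \<Rightarrow> 'a \<Rightarrow> 'p" where
  "last_pos w a = (THE p. p \<in> positions w \<and> lab w p = a \<and>
     (\<forall>q \<in> positions w. lab w q = a \<longrightarrow> (q, p) \<in> ord w))"

definition gless :: "('p, 'a) gword \<Rightarrow> 'p \<Rightarrow> 'p \<Rightarrow> bool" where
  "gless w p q \<longleftrightarrow> (p, q) \<in> ord w \<and> p \<noteq> q"

definition factor :: "('p, 'a) gword \<Rightarrow> 'p set \<Rightarrow> ('p, 'a) gword" where
  "factor w P = \<lparr>ord = Restr (ord w) P, lab = lab w\<rparr>"

definition X_left :: "('p, 'a) gword \<Rightarrow> 'a \<Rightarrow> ('p, 'a) gword" where
  "X_left w a = factor w {p. gless w p (first_pos w a)}"

definition X_right :: "('p, 'a) gword \<Rightarrow> 'a \<Rightarrow> ('p, 'a) gword" where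
  "X_right w a = factor w {p. gless w (first_pos w a) p}"

definition Y_left :: "('p, 'a) gword \<Rightarrow> 'a \<Rightarrow> ('p, 'a) gword" where
  "Y_left w a = factor w {p. gless w p (last_pos w a)}"

definition Y_right :: "('p, 'a) gword \<Rightarrow> 'a \<Rightarrow> ('p, 'a) gword" where
  "Y_right w a = factor w {p. gless w (last_pos w a) p}"

definition C_defined :: "('p, 'a) gword \<Rightarrow> 'a \<Rightarrow> 'a \<Rightarrow> bool" where
  "C_defined w a b \<longleftrightarrow> gless w (last_pos w b) (first_pos w a)"

definition C_factor :: "('p, 'a) gword \<Rightarrow> 'a \<Rightarrow> 'a \<Rightarrow> ('p, 'a) gword" where
  "C_factor w a b = factor w {p. gless w (last_pos w b) p \<and> gless w p (first_pos w a)}"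


section \<open>The relations\<close>

text \<open>
  These are meant for accessible words, where all first and last positions used below exist.
\<close>

fun eqX :: "nat \<Rightarrow> nat \<Rightarrow> ('p, 'a) gword \<Rightarrow> ('p, 'a) gword \<Rightarrow> bool"
and eqY :: "nat \<Rightarrow> nat \<Rightarrow> ('p, 'a) gword \<Rightarrow> ('p, 'a) gword \<Rightarrow> bool" where
  "eqX 0 n u v \<longleftrightarrow> True"
| "eqX (Suc m) 0 u v \<longleftrightarrow> True"
| "eqX (Suc m) (Suc n) u v \<longleftrightarrow>
     alph u = alph v \<and> eqY m n u v \<and>
     (\<forall>a \<in> alph u. eqY m n (X_left u a) (X_left v a) \<and>
                   eqX (Suc m) n (X_right u a) (X_right v a))"
| "eqY 0 n u v \<longleftrightarrow> True"
| "eqY (Suc m) 0 u v \<longleftrightarrow> True"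
| "eqY (Suc m) (Suc n) u v \<longleftrightarrow>
     alph u = alph v \<and> eqX m n u v \<and>
     (\<forall>a \<in> alph u. eqY (Suc m) n (Y_left u a) (Y_left v a) \<and>
                   eqX m n (Y_right u a) (Y_right v a))"

fun eqWI :: "nat \<Rightarrow> nat \<Rightarrow> ('p, 'a) gword \<Rightarrow> ('p, 'a) gword \<Rightarrow> bool" where
  "eqWI 0 n u v \<longleftrightarrow> True"
| "eqWI (Suc m) 0 u v \<longleftrightarrow> True"
| "eqWI (Suc m) (Suc n) u v \<longleftrightarrow>
     alph u = alph v \<and>
     (\<forall>a \<in> alph u. eqWI m n (X_left u a) (X_left v a) \<and>
                   eqWI (Suc m) n (X_right u a) (X_right v a) \<and>
                   eqWI (Suc m) n (Y_left u a) (Y_left v a) \<and>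
                   eqWI m n (Y_right u a) (Y_right v a)) \<and>
     (\<forall>a \<in> alph u. \<forall>b \<in> alph u.
        (C_defined u a b \<longleftrightarrow> C_defined v a b) \<and>
        (C_defined u a b \<longrightarrow> eqWI m n (C_factor u a b) (C_factor v a b)))"

datatype kind = X | Y | XY | WI

fun equiv_mn :: "kind \<Rightarrow> nat \<Rightarrow> nat \<Rightarrow> ('p, 'a) gword \<Rightarrow> ('p, 'a) gword \<Rightarrow> bool" where
  "equiv_mn X m n u v \<longleftrightarrow> eqX m n u v"
| "equiv_mn Y m n u v \<longleftrightarrow> eqY m n u v"
| "equiv_mn XY m n u v \<longleftrightarrow> eqX m n u v \<and> eqY m n u v"
| "equiv_mn WI m n u v \<longleftrightarrow> eqWI m n u v"

definition equiv_m :: "kind \<Rightarrow> nat \<Rightarrow> ('p, 'a) gword \<Rightarrow> ('p, 'a) gword \<Rightarrow> bool" where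
  "equiv_m Z m u v \<longleftrightarrow> (\<forall>n\<ge>1. equiv_mn Z m n u v)"


section \<open>Decidability\<close>

text \<open>
  The general recursive (total computable) functions of a given arity, with minimization
  restricted to regular functions. Only the values on argument lists of length equal to the
  arity are meaningful.
\<close>

inductive total_recursive :: "nat \<Rightarrow> (nat list \<Rightarrow> nat) \<Rightarrow> bool" where
  zero: "total_recursive n (\<lambda>_. 0)"
| succ: "total_recursive 1 (\<lambda>xs. Suc (xs ! 0))"
| proj: "i < n \<Longrightarrow> total_recursive n (\<lambda>xs. xs ! i)"
| comp: "total_recursive (length gs) f \<Longrightarrow> (\<forall>g \<in> set gs. total_recursive n g) \<Longrightarrow>
    total_recursive n (\<lambda>xs. f (map (\<lambda>g. g xs) gs))"
| prim_rec: "total_recursive n f \<Longrightarrow> total_recursive (Suc (Suc n)) g \<Longrightarrow>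
    total_recursive (Suc n)
      (\<lambda>xs. rec_nat (f (tl xs)) (\<lambda>k r. g (k # r # tl xs)) (hd xs))"
| mini: "total_recursive (Suc n) f \<Longrightarrow> (\<forall>xs. length xs = n \<longrightarrow> (\<exists>y. f (y # xs) = 0)) \<Longrightarrow>
    total_recursive n (\<lambda>xs. LEAST y. f (y # xs) = 0)"

text \<open>
  The decision problem \<open>P\<close> on the set \<open>I\<close> of instances, where \<open>code\<close> presents every
  instance as a list of \<open>k\<close> natural numbers.
\<close>

definition decidable_on :: "nat \<Rightarrow> ('i \<Rightarrow> nat list) \<Rightarrow> 'i set \<Rightarrow> ('i \<Rightarrow> bool) \<Rightarrow> bool" where
  "decidable_on k code I P \<longleftrightarrow>
     (\<exists>f. total_recursive k f \<and>
          (\<forall>x \<in> I. length (code x) = k \<and> f (code x) = (if P x then 1 else 0)))"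

fun code_term :: "nat pi_term \<Rightarrow> nat" where
  "code_term Eps = prod_encode (0, 0)"
| "code_term (Letter a) = prod_encode (1, a)"
| "code_term (Cat \<alpha> \<beta>) = prod_encode (2, prod_encode (code_term \<alpha>, code_term \<beta>))"
| "code_term (Power \<alpha>) = prod_encode (3, code_term \<alpha>)"

fun code_kind :: "kind \<Rightarrow> nat" where
  "code_kind X = 0"
| "code_kind Y = 1"
| "code_kind XY = 2"
| "code_kind WI = 3"

text \<open>
  Pairs of terms over a finite alphabet \<open>\<Sigma>\<close> whose letters are numbered injectively by \<open>c\<close>.
  The alphabet and its numbering belong to the instance, so that a decision procedure has to be
  uniform in them; it sees the letters only through their numbers.
\<close>

definition term_pairs :: "('a set \<times> ('a \<Rightarrow> nat) \<times> 'a pi_term \<times> 'a pi_term) set" where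
  "term_pairs = {(\<Sigma>, c, \<alpha>, \<beta>). finite \<Sigma> \<and> inj_on c \<Sigma> \<and> letters \<alpha> \<subseteq> \<Sigma> \<and> letters \<beta> \<subseteq> \<Sigma>}"

end

theory Submission
  imports Defs
begin

text \<open>
  The factors that occur in the relations are again denoted by \<open>\<pi>\<close>-terms: removing the first
  copy from \<open>\<omega> + \<omega>\<^sup>*\<close> many copies changes nothing, so that the factor right of the first \<open>a\<close> in
  \<open>(\<alpha>)\<^sup>\<pi>\<close> is denoted by \<open>\<alpha>'(\<alpha>)\<^sup>\<pi>\<close>, where \<open>\<alpha>'\<close> denotes the factor right of the first \<open>a\<close> in
  \<open>\<alpha>\<close>, and the factor left of it is the one in \<open>\<alpha>\<close>. Only finitely many terms arise from a given
  one in this way.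

  Unfolding the relations gives a transition system on pairs of terms together with a kind and a
  level \<open>m\<close>, and the equivalence for all \<open>n\<close> says that every reachable state passes a local
  test on alphabets. For the equivalence for all \<open>m\<close> the level is infinite. As the reachable part
  is finite if all of it passes the test, there is always either a finite set of states witnessing
  equivalence or a path witnessing inequivalence, and an unbounded search for one of the two
  decides the problem.
\<close>

section \<open>Computable functions on natural numbers\<close>

text \<open>The index \<open>n\<close> only bounds the number of unfoldings, so the quantification
  over \<open>n\<close> turns the relations into a condition on move sequences of any length. An
  infinite level treats all \<open>m\<close> at once, because lowering an infinite index leaves it
  infinite.

  Finiteness of the reachable part is not free: whether a move is legal is judged on the first term
  alone, and it is the tests already passed that make the same move meaningful for the second term
  and keep its factor among finitely many terms. Nothing is claimed for inequivalent pairs, which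
  have a failing path instead. Searching for either witness therefore replaces an explicit bound on
  the number of states.

  Two formal obstacles shape the rest. Factors must be compared without changing the type of
  positions, so terms are related to sets of positions inside one order rather than to words up to
  isomorphism. And minimization is granted only where the search succeeds on every argument, so
  every number has to decode to a state that possesses one of the two witnesses.\<close>

definition computes :: "nat \<Rightarrow> (nat list \<Rightarrow> nat) \<Rightarrow> bool" where
  "computes k f \<longleftrightarrow> (\<exists>g. total_recursive k g \<and> (\<forall>xs. length xs = k \<longrightarrow> g xs = f xs))"

text \<open>Values at lists of the wrong length carry no meaning. As \<open>computes\<close> ignores
  them, a function may be exchanged for any other that agrees on lists of length \<open>k\<close>, a
  freedom that the rules of \<open>total_recursive\<close> do not offer.\<close>

lemma computes_cong:
  assumes "computes k f" "\<And>xs. length xs = k \<Longrightarrow> f xs = g xs"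
  shows "computes k g"
  using assms unfolding computes_def by metis

lemma computes_zero: "computes k (\<lambda>_. 0)"
  unfolding computes_def using total_recursive.zero by blast

lemma computes_proj: "i < k \<Longrightarrow> computes k (\<lambda>xs. xs ! i)"
  unfolding computes_def using total_recursive.proj by blast

lemma computes_comp:
  assumes f: "computes (length gs) f" and gs: "\<forall>g \<in> set gs. computes k g"
  shows "computes k (\<lambda>xs. f (map (\<lambda>g. g xs) gs))"
proof -
  obtain F where F: "total_recursive (length gs) F" "\<And>xs. length xs = length gs \<Longrightarrow> F xs = f xs"
    using f unfolding computes_def by blast
  obtain G where G: "\<And>g. g \<in> set gs \<Longrightarrow> total_recursive k (G g)"
      "\<And>g xs. g \<in> set gs \<Longrightarrow> length xs = k \<Longrightarrow> G g xs = g xs"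
    using gs unfolding computes_def by metis
  have "total_recursive k (\<lambda>xs. F (map (\<lambda>g. g xs) (map G gs)))"
    using total_recursive.comp[of "map G gs" F k] F(1) G(1) by auto
  moreover have "F (map (\<lambda>g. g xs) (map G gs)) = f (map (\<lambda>g. g xs) gs)" if "length xs = k" for xs
    using F(2) G(2)[OF _ that] by (simp add: comp_def cong: map_cong)
  ultimately show ?thesis
    unfolding computes_def by blast
qed

lemma computes_comp1:
  assumes "computes 1 (\<lambda>xs. f (xs ! 0))" "computes k a"
  shows "computes k (\<lambda>xs. f (a xs))"
  using computes_comp[of "[a]" "\<lambda>xs. f (xs ! 0)" k] assms by simp

lemma computes_comp2:
  assumes "computes 2 (\<lambda>xs. f (xs ! 0) (xs ! 1))" "computes k a" "computes k b"
  shows "computes k (\<lambda>xs. f (a xs) (b xs))"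
  using computes_comp[of "[a, b]" "\<lambda>xs. f (xs ! 0) (xs ! 1)" k] assms by (simp add: numeral_2_eq_2)

lemma computes_Suc: "computes k a \<Longrightarrow> computes k (\<lambda>xs. Suc (a xs))"
  by (rule computes_comp1[of Suc]) (use total_recursive.succ in \<open>auto simp: computes_def\<close>)

lemma computes_rec:
  assumes f: "computes k f" and g: "computes (Suc (Suc k)) g"
  shows "computes (Suc k) (\<lambda>xs. rec_nat (f (tl xs)) (\<lambda>i r. g (i # r # tl xs)) (hd xs))"
proof -
  obtain F where F: "total_recursive k F" "\<And>xs. length xs = k \<Longrightarrow> F xs = f xs"
    using f unfolding computes_def by blast
  obtain G where G: "total_recursive (Suc (Suc k)) G" "\<And>xs. length xs = Suc (Suc k) \<Longrightarrow> G xs = g xs"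
    using g unfolding computes_def by blast
  show ?thesis
    unfolding computes_def using total_recursive.prim_rec[OF F(1) G(1)] F(2) G(2)
    by (intro exI[of _ "\<lambda>xs. rec_nat (F (tl xs)) (\<lambda>k r. G (k # r # tl xs)) (hd xs)"]) auto
qed

lemma computes_rec2:
  assumes "computes 1 (\<lambda>xs. z (xs ! 0))" "computes 3 (\<lambda>xs. s (xs ! 0) (xs ! 1) (xs ! 2))"
  shows "computes 2 (\<lambda>xs. rec_nat (z (xs ! 1)) (\<lambda>i r. s i r (xs ! 1)) (xs ! 0))"
proof -
  have "computes 2 (\<lambda>xs. rec_nat (z (tl xs ! 0))
      (\<lambda>i r. s ((i # r # tl xs) ! 0) ((i # r # tl xs) ! 1) ((i # r # tl xs) ! 2)) (hd xs))"
    using computes_rec[of 1 "\<lambda>xs. z (xs ! 0)" "\<lambda>xs. s (xs ! 0) (xs ! 1) (xs ! 2)"] assms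
    by (simp add: numeral_2_eq_2 numeral_3_eq_3)
  then show ?thesis
  proof (rule computes_cong)
    fix xs :: "nat list" assume "length xs = 2"
    then obtain x y where "xs = [x, y]"
      by (auto simp: numeral_2_eq_2 length_Suc_conv)
    then show "rec_nat (z (tl xs ! 0))
      (\<lambda>i r. s ((i # r # tl xs) ! 0) ((i # r # tl xs) ! 1) ((i # r # tl xs) ! 2)) (hd xs) =
      rec_nat (z (xs ! 1)) (\<lambda>i r. s i r (xs ! 1)) (xs ! 0)" by simp
  qed
qed

lemma computes_rec1:
  assumes "computes 2 (\<lambda>xs. s (xs ! 0) (xs ! 1))"
  shows "computes 1 (\<lambda>xs. rec_nat 0 s (xs ! 0))"
proof (rule computes_cong)
  show "computes 1 (\<lambda>xs. rec_nat 0 (\<lambda>i r. s ((i # r # tl xs) ! 0) ((i # r # tl xs) ! 1)) (hd xs))"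
    using computes_rec[OF computes_zero[of 0], of "\<lambda>xs. s (xs ! 0) (xs ! 1)"] assms
    by (simp add: numeral_2_eq_2)
next
  fix xs :: "nat list" assume "length xs = 1"
  then obtain x where "xs = [x]"
    by (auto simp: length_Suc_conv)
  then show "rec_nat 0 (\<lambda>i r. s ((i # r # tl xs) ! 0) ((i # r # tl xs) ! 1)) (hd xs) = rec_nat 0 s (xs ! 0)"
    by simp
qed

lemma computes_Least:
  assumes f: "computes (Suc k) f" and ex: "\<And>xs. length xs = k \<Longrightarrow> \<exists>y. f (y # xs) = 0"
  shows "computes k (\<lambda>xs. LEAST y. f (y # xs) = 0)"
proof -
  obtain F where F: "total_recursive (Suc k) F" "\<And>xs. length xs = Suc k \<Longrightarrow> F xs = f xs"
    using f unfolding computes_def by blast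
  show ?thesis
    unfolding computes_def using total_recursive.mini[OF F(1)] F(2) ex
    by (intro exI[of _ "\<lambda>xs. LEAST y. F (y # xs) = 0"]) auto
qed

lemma computes_add: "computes k a \<Longrightarrow> computes k b \<Longrightarrow> computes k (\<lambda>xs. a xs + b xs)"
proof (rule computes_comp2[of "(+)"])
  have *: "rec_nat y (\<lambda>i r. Suc r) x = x + y" for x y :: nat
    by (induction x) auto
  show "computes 2 (\<lambda>xs. xs ! 0 + xs ! 1)"
    using computes_rec2[OF computes_proj[of 0], of "\<lambda>i r y. Suc r"]
    by (simp add: * computes_Suc computes_proj)
qed

lemma computes_pred: "computes k a \<Longrightarrow> computes k (\<lambda>xs. a xs - 1)"
proof (rule computes_comp1[of "\<lambda>x. x - 1"])
  have *: "rec_nat 0 (\<lambda>i r. i) x = x - 1" for x :: nat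
    by (cases x) auto
  show "computes 1 (\<lambda>xs. xs ! 0 - 1)"
    using computes_rec1[of "\<lambda>i r. i"] by (simp add: * computes_proj)
qed

lemma computes_diff: "computes k a \<Longrightarrow> computes k b \<Longrightarrow> computes k (\<lambda>xs. a xs - b xs)"
proof (rule computes_comp2[of "\<lambda>x y. y - x", where a = b and b = a])
  have *: "rec_nat y (\<lambda>i r. r - 1) x = y - x" for x y :: nat
    by (induction x) auto
  show "computes 2 (\<lambda>xs. xs ! 1 - xs ! 0)"
  proof -
    have "computes 2 (\<lambda>xs. rec_nat (xs ! 1) (\<lambda>i r. r - 1) (xs ! 0))"
      using computes_rec2[OF computes_proj[of 0], of "\<lambda>i r y. r - 1"]
        computes_pred[OF computes_proj[of 1 3]] by simp
    then show ?thesis by (simp only: *)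
  qed
qed

lemma computes_triangle: "computes k a \<Longrightarrow> computes k (\<lambda>xs. triangle (a xs))"
proof (rule computes_comp1[of triangle])
  have *: "rec_nat 0 (\<lambda>i r. r + Suc i) x = triangle x" for x :: nat
    by (induction x) auto
  show "computes 1 (\<lambda>xs. triangle (xs ! 0))"
    using computes_rec1[of "\<lambda>i r. r + Suc i"]
    by (simp only: * computes_add computes_Suc computes_proj One_nat_def numeral_2_eq_2 lessI zero_less_Suc Suc_less_eq)
qed

section \<open>The pairing function and its projections\<close>

definition pair :: "nat \<Rightarrow> nat \<Rightarrow> nat" where "pair a b = prod_encode (a, b)"
definition pfst :: "nat \<Rightarrow> nat" where "pfst x = fst (prod_decode x)"
definition psnd :: "nat \<Rightarrow> nat" where "psnd x = snd (prod_decode x)"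

lemma pfst_pair [simp]: "pfst (pair a b) = a"
  and psnd_pair [simp]: "psnd (pair a b) = b"
  and pair_pfst_psnd [simp]: "pair (pfst x) (psnd x) = x"
  by (simp_all add: pair_def pfst_def psnd_def)

lemma pair_cases: obtains a b where "x = pair a b"
  by (metis pair_pfst_psnd)

lemma computes_pair: "computes k a \<Longrightarrow> computes k b \<Longrightarrow> computes k (\<lambda>xs. pair (a xs) (b xs))"
  by (simp add: pair_def prod_encode_def computes_add computes_triangle)

lemma triangle_mono: "m \<le> n \<Longrightarrow> triangle m \<le> triangle n"
  by (rule lift_Suc_mono_le[of triangle]) auto

text \<open>\<open>pair m n\<close> is Cantor's \<open>triangle (m + n) + m\<close>, so the diagonal
  \<open>m + n\<close> is the least \<open>k\<close> with
  \<open>pair m n < triangle (Suc k)\<close>. The inequality appears as a vanishing truncated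
  difference because minimization searches for zeros.\<close>

lemma Least_triangle_pair: "(LEAST k. Suc (pair m n) - triangle (Suc k) = 0) = m + n"
proof (rule Least_equality)
  show "Suc (pair m n) - triangle (Suc (m + n)) = 0"
    by (simp add: pair_def prod_encode_def)
next
  fix k assume k: "Suc (pair m n) - triangle (Suc k) = 0"
  show "m + n \<le> k"
  proof (rule ccontr)
    assume "\<not> m + n \<le> k"
    then have "triangle (Suc k) \<le> triangle (m + n)"
      by (intro triangle_mono) auto
    with k show False
      by (simp add: pair_def prod_encode_def)
  qed
qed

text \<open>With the diagonal \<open>D\<close> obtained by minimization, the first component is the
  offset of the code on its diagonal, and the second is what remains of the diagonal.\<close>

lemma computes_pfst_psnd:
  assumes "computes k a"
  shows "computes k (\<lambda>xs. pfst (a xs))" "computes k (\<lambda>xs. psnd (a xs))"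
proof -
  define D where "D z = (LEAST k. Suc z - triangle (Suc k) = 0)" for z
  have D: "D (pair m n) = m + n" for m n
    unfolding D_def by (rule Least_triangle_pair)
  have cD: "computes 1 (\<lambda>xs. D (xs ! 0))"
  proof (rule computes_cong)
    show "computes 1 (\<lambda>xs. LEAST y. Suc ((y # xs) ! 1) - triangle (Suc ((y # xs) ! 0)) = 0)"
    proof (rule computes_Least)
      show "computes (Suc 1) (\<lambda>xs. Suc (xs ! 1) - triangle (Suc (xs ! 0)))"
        by (intro computes_diff computes_Suc computes_triangle computes_proj) auto
    next
      fix xs :: "nat list"
      obtain a b where "xs ! 0 = pair a b" by (rule pair_cases)
      then have "Suc ((y # xs) ! 1) - triangle (Suc ((y # xs) ! 0)) = 0" if "y = a + b" for y
        using that by (simp add: pair_def prod_encode_def)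
      then show "\<exists>y. Suc ((y # xs) ! 1) - triangle (Suc ((y # xs) ! 0)) = 0" by blast
    qed
  qed (simp add: D_def)
  have 1: "pfst z = z - triangle (D z)" for z
  proof -
    obtain a b where "z = pair a b" by (rule pair_cases)
    then show ?thesis by (simp add: D) (simp add: pair_def prod_encode_def)
  qed
  have 2: "psnd z = D z - pfst z" for z
  proof -
    obtain a b where "z = pair a b" by (rule pair_cases)
    then show ?thesis by (simp add: D)
  qed
  have cDa: "computes k (\<lambda>xs. D (a xs))"
    by (rule computes_comp1[OF cD assms])
  show c1: "computes k (\<lambda>xs. pfst (a xs))"
    unfolding 1 by (intro computes_diff computes_triangle assms cDa)
  show "computes k (\<lambda>xs. psnd (a xs))"
    unfolding 2 by (intro computes_diff c1 cDa)
qed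

section \<open>Computable functions and decidable predicates of one argument\<close>

definition computable :: "(nat \<Rightarrow> nat) \<Rightarrow> bool" where
  "computable f \<longleftrightarrow> computes 1 (\<lambda>xs. f (xs ! 0))"

lemma computes_computable: "computable f \<Longrightarrow> computes k a \<Longrightarrow> computes k (\<lambda>xs. f (a xs))"
  unfolding computable_def by (rule computes_comp1)

definition decidable :: "(nat \<Rightarrow> bool) \<Rightarrow> bool" where
  "decidable P \<longleftrightarrow> computable (\<lambda>x. if P x then 1 else 0)"

text \<open>Functions of several arguments are handled as functions of a nested pair: the rules below
  decompose a goal \<open>computable (\<lambda>x. e x)\<close> along the structure of \<open>e\<close>, where binding a further
  variable turns \<open>x\<close> into a pair.\<close>

named_theorems computable_intros

lemma computable_id [computable_intros]: "computable (\<lambda>x. x)"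
  by (simp add: computable_def computes_proj)

lemma computable_const [computable_intros]: "computable (\<lambda>_. c)"
  unfolding computable_def by (induction c) (auto intro: computes_zero computes_Suc)

lemma computable_basic [computable_intros]:
  assumes "computable f" "computable g"
  shows "computable (\<lambda>x. f x + g x)" "computable (\<lambda>x. f x - g x)" "computable (\<lambda>x. pair (f x) (g x))"
  using assms unfolding computable_def
  by (auto intro: computes_add computes_diff computes_pair)

lemma computable_unary [computable_intros]:
  assumes "computable f"
  shows "computable (\<lambda>x. Suc (f x))" "computable (\<lambda>x. pfst (f x))" "computable (\<lambda>x. psnd (f x))"
  using assms unfolding computable_def
  by (auto intro: computes_Suc computes_pfst_psnd)

lemma computable_comp:
  assumes "computable f" "computable g"
  shows "computable (\<lambda>x. f (g x))"
  using assms computes_computable unfolding computable_def by blast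

lemma computable_comp2:
  assumes "computable (\<lambda>p. f (pfst p) (psnd p))" "computable g" "computable h"
  shows "computable (\<lambda>x. f (g x) (h x))"
  using computable_comp[OF assms(1) computable_basic(3)[OF assms(2,3)]] by simp

lemma computable_comp3:
  assumes "computable (\<lambda>p. f (pfst p) (pfst (psnd p)) (psnd (psnd p)))" "computable g" "computable h" "computable i"
  shows "computable (\<lambda>x. f (g x) (h x) (i x))"
  using computable_comp[OF assms(1) computable_basic(3)[OF assms(2) computable_basic(3)[OF assms(3,4)]]] by simp

lemma computable_rec [computable_intros]:
  assumes n: "computable n" and z: "computable z"
    and s: "computable (\<lambda>p. s (pfst p) (pfst (psnd p)) (psnd (psnd p)))"
  shows "computable (\<lambda>x. rec_nat (z x) (\<lambda>i r. s i r x) (n x))"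
proof -
  have "computes 2 (\<lambda>xs. rec_nat (z (xs ! 1)) (\<lambda>i r. s i r (xs ! 1)) (xs ! 0))"
  proof (rule computes_rec2)
    show "computes 1 (\<lambda>xs. z (xs ! 0))" using z unfolding computable_def .
    have "computes 3 (\<lambda>xs. pair (xs ! 0) (pair (xs ! 1) (xs ! 2)))"
      by (intro computes_pair computes_proj) auto
    from computes_computable[OF s this]
    show "computes 3 (\<lambda>xs. s (xs ! 0) (xs ! 1) (xs ! 2))" by simp
  qed
  from computes_comp2[OF this, of 1 "\<lambda>xs. n (xs ! 0)" "\<lambda>xs. xs ! 0"] n show ?thesis
    using computes_proj[of 0 1] by (simp add: computable_def)
qed

lemma computable_if [computable_intros]:
  assumes "decidable P" "computable f" "computable g"
  shows "computable (\<lambda>x. if P x then f x else g x)"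
proof -
  \<comment> \<open>A case distinction is a primitive recursion of length 0 or 1.\<close>
  have "computable (\<lambda>x. rec_nat (g x) (\<lambda>i r. f x) (if P x then 1 else 0))"
    using assms(1) unfolding decidable_def
    by (intro computable_rec assms computable_comp[OF assms(2)] computable_unary computable_id)
  moreover have "rec_nat (g x) (\<lambda>i r. f x) (if P x then 1 else 0) = (if P x then f x else g x)" for x
    by simp
  ultimately show ?thesis by simp
qed

lemma decidable_less [computable_intros]:
  assumes "computable f" "computable g"
  shows "decidable (\<lambda>x. f x < g x)"
proof -
  have "computable (\<lambda>x. 1 - (1 - (g x - f x)))"
    by (intro computable_intros assms)
  moreover have "1 - (1 - (g x - f x)) = (if f x < g x then 1 else 0)" for x
    by auto
  ultimately show ?thesis unfolding decidable_def by simp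
qed

lemma decidable_not [computable_intros]:
  assumes "decidable P"
  shows "decidable (\<lambda>x. \<not> P x)"
proof -
  have "computable (\<lambda>x. if P x then 0 else 1)"
    by (intro computable_intros assms)
  moreover have "(if P x then 0 else 1) = (if \<not> P x then 1 else (0::nat))" for x
    by auto
  ultimately show ?thesis unfolding decidable_def by simp
qed

lemma decidable_connectives [computable_intros]:
  assumes P: "decidable P" and Q: "decidable Q"
  shows "decidable (\<lambda>x. P x \<and> Q x)" "decidable (\<lambda>x. P x \<or> Q x)"
    "decidable (\<lambda>x. P x \<longrightarrow> Q x)" "decidable (\<lambda>x. P x \<longleftrightarrow> Q x)"
proof -
  have 2: "decidable (\<lambda>x. P' x \<and> Q' x)" if "decidable P'" "decidable Q'" for P' Q'
  proof -
    have "computable (\<lambda>x. if P' x then if Q' x then 1 else 0 else 0)"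
      by (intro computable_intros that)
    moreover have "(if P' x then if Q' x then 1 else 0 else 0) = (if P' x \<and> Q' x then 1 else (0::nat))" for x
      by auto
    ultimately show ?thesis unfolding decidable_def by simp
  qed
  show "decidable (\<lambda>x. P x \<and> Q x)" by (intro 2 assms)
  have "decidable (\<lambda>x. \<not> (\<not> P x \<and> \<not> Q x))" by (intro computable_intros 2 assms)
  then show "decidable (\<lambda>x. P x \<or> Q x)" by simp
  have "decidable (\<lambda>x. \<not> (P x \<and> \<not> Q x))" by (intro computable_intros 2 assms)
  then show "decidable (\<lambda>x. P x \<longrightarrow> Q x)" by simp
  have "decidable (\<lambda>x. \<not> (P x \<and> \<not> Q x) \<and> \<not> (Q x \<and> \<not> P x))" by (intro computable_intros 2 assms)
  moreover have "(\<not> (P x \<and> \<not> Q x) \<and> \<not> (Q x \<and> \<not> P x)) = (P x \<longleftrightarrow> Q x)" for x by auto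
  ultimately show "decidable (\<lambda>x. P x \<longleftrightarrow> Q x)" by simp
qed

lemma decidable_le_eq [computable_intros]:
  assumes f: "computable f" and g: "computable g"
  shows "decidable (\<lambda>x. f x \<le> g x)" "decidable (\<lambda>x. f x = g x)"
proof -
  have "decidable (\<lambda>x. \<not> g x < f x)"
    by (intro computable_intros f g)
  then show "decidable (\<lambda>x. f x \<le> g x)" by (simp add: not_less)
  have "decidable (\<lambda>x. \<not> g x < f x \<and> \<not> f x < g x)"
    by (intro computable_intros f g)
  moreover have "(\<not> g x < f x \<and> \<not> f x < g x) = (f x = g x)" for x by auto
  ultimately show "decidable (\<lambda>x. f x = g x)" by simp
qed

lemma decidable_comp:
  assumes "decidable P" "computable g"
  shows "decidable (\<lambda>x. P (g x))"
  using computable_comp[OF assms(1)[unfolded decidable_def] assms(2)] unfolding decidable_def .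

lemma decidable_comp2:
  assumes "decidable (\<lambda>p. P (pfst p) (psnd p))" "computable g" "computable h"
  shows "decidable (\<lambda>x. P (g x) (h x))"
  using decidable_comp[OF assms(1) computable_basic(3)[OF assms(2,3)]] by simp

lemma decidable_ball [computable_intros]:
  assumes n: "computable n" and P: "decidable (\<lambda>p. P (pfst p) (psnd p))"
  shows "decidable (\<lambda>x. \<forall>i\<le>n x. P i x)"
proof -
  have P': "decidable (\<lambda>t. P (pfst t) (psnd (psnd t)))"
    by (rule decidable_comp2[OF P]; intro computable_intros)
  have "computable (\<lambda>x. rec_nat 1 (\<lambda>i r. if P i x then r else 0) (Suc (n x)))"
    by (intro computable_intros n P')
  moreover have "rec_nat 1 (\<lambda>i r. if P i x then r else 0) k = (if \<forall>i<k. P i x then 1 else (0::nat))" for x k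
    by (induction k) (auto simp: less_Suc_eq)
  ultimately show ?thesis unfolding decidable_def less_Suc_eq_le by (simp only: less_Suc_eq_le)
qed

text \<open>The existence of \<open>y\<close> is demanded for every number \<open>x\<close>, because
  minimization is confined to regular functions.\<close>

lemma computable_Least:
  assumes P: "decidable (\<lambda>p. P (pfst p) (psnd p))" and ex: "\<And>x. \<exists>y. P y x"
  shows "computable (\<lambda>x. LEAST y. P y x)"
proof -
  define f where "f xs = (if P (xs ! 0) (xs ! 1) then 0 else 1 :: nat)" for xs
  have "computes 2 f"
  proof -
    have "computable (\<lambda>p. if P (pfst p) (psnd p) then 0 else 1)"
      by (intro computable_intros P)
    moreover have "computes 2 (\<lambda>xs. pair (xs ! 0) (xs ! 1))"
      by (intro computes_pair computes_proj) auto
    ultimately have "computes 2 (\<lambda>xs. if P (pfst (pair (xs ! 0) (xs ! 1))) (psnd (pair (xs ! 0) (xs ! 1))) then 0 else 1)"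
      by (rule computes_computable)
    then show ?thesis by (simp add: f_def[abs_def])
  qed
  moreover have f: "f (y # xs) = 0 \<longleftrightarrow> P y (xs ! 0)" for y xs
    by (simp add: f_def)
  ultimately have "computes 1 (\<lambda>xs. LEAST y. f (y # xs) = 0)"
    by (intro computes_Least) (simp_all add: numeral_2_eq_2 ex)
  then show ?thesis unfolding computable_def f .
qed

lemma computable_funpow [computable_intros]:
  assumes "computable n" "computable f" "computable z"
  shows "computable (\<lambda>x. (f ^^ n x) (z x))"
proof -
  have "computable (\<lambda>x. rec_nat (z x) (\<lambda>i r. f r) (n x))"
    by (intro computable_rec assms computable_comp[OF assms(2)] computable_intros)
  moreover have "rec_nat z (\<lambda>i r. f r) n = (f ^^ n) z" for z n
    by (induction n) auto
  ultimately show ?thesis by simp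
qed

section \<open>Factors of terms\<close>

text \<open>Meaningful if \<open>a\<close> occurs in the term. The last equation then concerns only
  the term \<open>Letter a\<close>, which has nothing to the left of its \<open>a\<close>.\<close>

fun term_X_left :: "'a pi_term \<Rightarrow> 'a \<Rightarrow> 'a pi_term" where
  "term_X_left (Cat s t) a = (if a \<in> letters s then term_X_left s a else Cat s (term_X_left t a))"
| "term_X_left (Power t) a = term_X_left t a"
| "term_X_left _ a = Eps"

fun term_X_right :: "'a pi_term \<Rightarrow> 'a \<Rightarrow> 'a pi_term" where
  "term_X_right (Cat s t) a = (if a \<in> letters s then Cat (term_X_right s a) t else term_X_right t a)"
| "term_X_right (Power t) a = Cat (term_X_right t a) (Power t)"
| "term_X_right _ a = Eps"

fun term_Y_left :: "'a pi_term \<Rightarrow> 'a \<Rightarrow> 'a pi_term" where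
  "term_Y_left (Cat s t) a = (if a \<in> letters t then Cat s (term_Y_left t a) else term_Y_left s a)"
| "term_Y_left (Power t) a = Cat (Power t) (term_Y_left t a)"
| "term_Y_left _ a = Eps"

fun term_Y_right :: "'a pi_term \<Rightarrow> 'a \<Rightarrow> 'a pi_term" where
  "term_Y_right (Cat s t) a = (if a \<in> letters t then term_Y_right t a else Cat (term_Y_right s a) t)"
| "term_Y_right (Power t) a = term_Y_right t a"
| "term_Y_right _ a = Eps"

text \<open>A finite superset of the iterated factors, chosen for being closed. For
  \<open>Power s\<close>, cutting on the right, on the left or on both sides leaves
  \<open>Power s\<close> with a factor of \<open>s\<close> on the respective sides; the two
  bracketings occur because \<open>Cat\<close> is not associative as a constructor. The shape
  \<open>Cat u v\<close> without \<open>Power s\<close> arises when a cut falls inside the first or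
  the last copy and removes the middle.\<close>

fun factors :: "'a pi_term \<Rightarrow> 'a pi_term set" where
  "factors Eps = {Eps}"
| "factors (Letter a) = {Letter a, Eps}"
| "factors (Cat s t) =
     (\<lambda>(u, v). Cat u v) ` (factors s \<times> factors t) \<union> factors s \<union> factors t"
| "factors (Power s) = {Power s} \<union> factors s
     \<union> (\<lambda>u. Cat u (Power s)) ` factors s
     \<union> (\<lambda>v. Cat (Power s) v) ` factors s
     \<union> (\<lambda>(u, v). Cat (Cat u (Power s)) v) ` (factors s \<times> factors s)
     \<union> (\<lambda>(u, v). Cat u (Cat (Power s) v)) ` (factors s \<times> factors s)
     \<union> (\<lambda>(u, v). Cat u v) ` (factors s \<times> factors s)"

lemma finite_factors [simp]: "finite (factors t)"
  by (induction t) auto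

lemma factors_refl [simp]: "t \<in> factors t"
  by (induction t) auto

lemma letters_factors: "u \<in> factors t \<Longrightarrow> letters u \<subseteq> letters t"
  by (induction t arbitrary: u) fastforce+

text \<open>Terms do not grow in the \<open>Power s\<close> case because \<open>Power s\<close>
  contains every letter of its factors: the first \<open>a\<close> is found at the latest there, and
  the last \<open>a\<close> too when searching from the right. So never more than one factor of
  \<open>s\<close> accumulates on either side.\<close>

lemma factors_closed:
  assumes "u \<in> factors t" "a \<in> letters u"
  shows "term_X_left u a \<in> factors t" "term_X_right u a \<in> factors t" "term_Y_left u a \<in> factors t" "term_Y_right u a \<in> factors t"
proof -
  have "term_X_left u a \<in> factors t \<and> term_X_right u a \<in> factors t \<and> term_Y_left u a \<in> factors t \<and> term_Y_right u a \<in> factors t"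
    using assms
  proof (induction t arbitrary: u)
    case (Power s)
    have sub: "a \<in> letters v \<Longrightarrow> a \<in> letters s" if "v \<in> factors s" for v
      using letters_factors[OF that] by blast
    have as: "a \<in> letters s"
      using letters_factors[OF Power.prems(1)] Power.prems(2) by auto
    note IH = Power.IH[OF factors_refl as]
    from Power.prems(1) consider "u = Power s" | "u \<in> factors s"
      | v where "v \<in> factors s" "u = Cat v (Power s)"
      | v where "v \<in> factors s" "u = Cat (Power s) v"
      | v w where "v \<in> factors s" "w \<in> factors s" "u = Cat (Cat v (Power s)) w"
      | v w where "v \<in> factors s" "w \<in> factors s" "u = Cat v (Cat (Power s) w)"
      | v w where "v \<in> factors s" "w \<in> factors s" "u = Cat v w"
      by auto
    then show ?case
    proof cases
      case 1
      then show ?thesis using IH as by auto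
    next
      case 2
      then show ?thesis using Power.IH Power.prems(2) by auto
    next
      case (3 v)
      then show ?thesis using IH as Power.IH[OF 3(1)] by (cases "a \<in> letters v") auto
    next
      case (4 v)
      then show ?thesis using IH as Power.IH[OF 4(1)] by (cases "a \<in> letters v") auto
    next
      case (5 v w)
      then show ?thesis using IH as Power.IH[OF 5(1)] Power.IH[OF 5(2)]
        by (cases "a \<in> letters v"; cases "a \<in> letters w") auto
    next
      case (6 v w)
      then show ?thesis using IH as Power.IH[OF 6(1)] Power.IH[OF 6(2)]
        by (cases "a \<in> letters v"; cases "a \<in> letters w") auto
    next
      case (7 v w)
      then show ?thesis using IH as Power.prems(2) Power.IH[OF 7(1)] Power.IH[OF 7(2)]
        by (cases "a \<in> letters v"; cases "a \<in> letters w") auto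
    qed
  next
    case (Cat s t)
    from Cat.prems(1) consider "u \<in> factors s" | "u \<in> factors t"
      | v w where "v \<in> factors s" "w \<in> factors t" "u = Cat v w"
      by auto
    then show ?case
    proof cases
      case 1
      then show ?thesis using Cat.IH(1) Cat.prems(2) by auto
    next
      case 2
      then show ?thesis using Cat.IH(2) Cat.prems(2) by auto
    next
      case (3 v w)
      then show ?thesis using Cat.prems(2) Cat.IH(1)[OF 3(1)] Cat.IH(2)[OF 3(2)]
        by (cases "a \<in> letters v"; cases "a \<in> letters w") auto
    qed
  qed auto
  then show "term_X_left u a \<in> factors t" "term_X_right u a \<in> factors t" "term_Y_left u a \<in> factors t" "term_Y_right u a \<in> factors t"
    by auto
qed

text \<open>Reversal exchanges first and last occurrences, so the induction over terms is needed for
  first occurrences only. \<open>Power\<close> goes to \<open>Power\<close> because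
  \<open>omega_plus_omega_star\<close> is isomorphic to its converse.\<close>

fun reverse_term :: "'a pi_term \<Rightarrow> 'a pi_term" where
  "reverse_term (Cat s t) = Cat (reverse_term t) (reverse_term s)"
| "reverse_term (Power t) = Power (reverse_term t)"
| "reverse_term t = t"

lemma letters_reverse_term [simp]: "letters (reverse_term t) = letters t"
  by (induction t rule: reverse_term.induct) auto

lemma reverse_term_reverse_term [simp]: "reverse_term (reverse_term t) = t"
  by (induction t rule: reverse_term.induct) auto

lemma term_X_left_reverse: "term_X_left (reverse_term t) a = reverse_term (term_Y_right t a)"
  by (induction t rule: reverse_term.induct) auto

lemma term_X_right_reverse: "term_X_right (reverse_term t) a = reverse_term (term_Y_left t a)"
  by (induction t rule: reverse_term.induct) auto

text \<open>Used to conclude that a letter other than \<open>b\<close> which does not occur left of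
  the last \<open>b\<close> occurs right of it.\<close>

lemma letters_split: "b \<in> letters t \<Longrightarrow> letters t = insert b (letters (term_Y_left t b) \<union> letters (term_Y_right t b))"
  by (induction t) auto

text \<open>The first \<open>a\<close> is to the right of the last \<open>b\<close> iff no \<open>a\<close> is to the left of the last
  \<open>b\<close>, and then it is also the first \<open>a\<close> of the factor right of the last \<open>b\<close>.\<close>

definition term_C_defined :: "'a pi_term \<Rightarrow> 'a \<Rightarrow> 'a \<Rightarrow> bool" where
  "term_C_defined t a b \<longleftrightarrow> a \<noteq> b \<and> a \<notin> letters (term_Y_left t b)"

definition term_C :: "'a pi_term \<Rightarrow> 'a \<Rightarrow> 'a \<Rightarrow> 'a pi_term" where
  "term_C t a b = term_X_left (term_Y_right t b) a"

section \<open>Sets of positions spelling a term\<close>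

definition precedes :: "'p rel \<Rightarrow> 'p set \<Rightarrow> 'p set \<Rightarrow> bool" where
  "precedes r A B \<longleftrightarrow> (\<forall>p \<in> A. \<forall>q \<in> B. (p, q) \<in> r \<and> p \<noteq> q)"

text \<open>A substitute for isomorphism with the interpretation of the term. As it speaks about
  subsets of one fixed order, taking factors never changes the type or the order.\<close>

fun spells :: "'p rel \<Rightarrow> ('p \<Rightarrow> 'a) \<Rightarrow> 'p set \<Rightarrow> 'a pi_term \<Rightarrow> bool" where
  "spells r l A Eps \<longleftrightarrow> A = {}"
| "spells r l A (Letter a) \<longleftrightarrow> (\<exists>p. A = {p} \<and> l p = a)"
| "spells r l A (Cat s t) \<longleftrightarrow>
     (\<exists>B C. A = B \<union> C \<and> precedes r B C \<and> spells r l B s \<and> spells r l C t)"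
| "spells r l A (Power t) \<longleftrightarrow>
     (\<exists>B. A = (\<Union>i\<in>-{0}. B i) \<and>
          (\<forall>i j. (i, j) \<in> omega_plus_omega_star \<and> i \<noteq> j \<longrightarrow> precedes r (B i) (B j)) \<and>
          (\<forall>i\<in>-{0::int}. spells r l (B i) t))"

lemma spells_map: "spells r l A t \<Longrightarrow> spells r (f \<circ> l) A (map_pi_term f t)"
proof (induction t arbitrary: A)
  case (Power t)
  then obtain B where "A = (\<Union>i\<in>-{0}. B i)" "\<forall>i\<in>-{0::int}. spells r l (B i) t"
    "\<forall>i j. (i, j) \<in> omega_plus_omega_star \<and> i \<noteq> j \<longrightarrow> precedes r (B i) (B j)" by auto
  then show ?case using Power.IH by (auto intro!: exI[of _ B])
next
  case (Cat s t)
  then obtain B C where "A = B \<union> C" "precedes r B C" "spells r l B s" "spells r l C t" by auto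
  then show ?case using Cat.IH unfolding spells.simps pi_term.map by blast
qed auto

lemma letters_spells: "spells r l A t \<Longrightarrow> l ` A = letters t"
proof (induction t arbitrary: A)
  case (Power t)
  then obtain B where "A = (\<Union>i\<in>-{0}. B i)" "\<forall>i\<in>-{0::int}. spells r l (B i) t" by auto
  then have A: "A = (\<Union>i\<in>-{0}. B i)" and B: "l ` B i = letters t" if "i \<noteq> 0" for i
    using Power.IH that by auto
  have "l ` A = (\<Union>i\<in>-{0::int}. letters t)"
    using B by (simp add: A[of 1] image_UN)
  moreover have "- {0::int} \<noteq> {}"
    by (metis ComplI empty_iff singletonD zero_neq_one)
  ultimately show ?case by simp
next
  case (Cat s t)
  then obtain B C where "A = B \<union> C" "spells r l B s" "spells r l C t" by auto
  with Cat.IH show ?case by (simp add: image_Un)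
qed auto

lemma precedes_transfer:
  assumes "precedes r A B" "\<And>p q. p \<in> A \<Longrightarrow> q \<in> B \<Longrightarrow> (p, q) \<in> r \<Longrightarrow> p \<noteq> q \<Longrightarrow> (f p, f q) \<in> r' \<and> f p \<noteq> f q"
  shows "precedes r' (f ` A) (f ` B)"
  using assms unfolding precedes_def by blast

text \<open>\<open>spells\<close> only demands that certain pairs are in the order, so a map that
  preserves strict comparisons within \<open>A\<close> suffices. This covers both the embedding of a
  subterm's positions into a larger word and the passage to a restricted order.\<close>

lemma spells_image:
  assumes "spells r l A t"
    "\<And>p q. p \<in> A \<Longrightarrow> q \<in> A \<Longrightarrow> (p, q) \<in> r \<Longrightarrow> p \<noteq> q \<Longrightarrow> (f p, f q) \<in> r' \<and> f p \<noteq> f q"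
    "\<And>p. p \<in> A \<Longrightarrow> l' (f p) = l p"
  shows "spells r' l' (f ` A) t"
  using assms
proof (induction t arbitrary: A)
  case (Cat s t)
  then obtain B C where *: "A = B \<union> C" "precedes r B C" "spells r l B s" "spells r l C t" by auto
  have "spells r' l' (f ` B) s"
    by (rule Cat.IH(1)[OF *(3)]; use Cat.prems(2,3) *(1) in blast)
  moreover have "spells r' l' (f ` C) t"
    by (rule Cat.IH(2)[OF *(4)]; use Cat.prems(2,3) *(1) in blast)
  moreover have "precedes r' (f ` B) (f ` C)"
    using Cat.prems(2) *(1) by (intro precedes_transfer[OF *(2)]) blast+
  ultimately show ?case using *(1) by (auto simp: image_Un)
next
  case (Power t)
  then obtain B where *: "A = (\<Union>i\<in>-{0}. B i)" "\<forall>i\<in>-{0::int}. spells r l (B i) t"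
    "\<forall>i j. (i, j) \<in> omega_plus_omega_star \<and> i \<noteq> j \<longrightarrow> precedes r (B i) (B j)" by auto
  have sub: "B i \<subseteq> A" if "i \<noteq> 0" for i
    using *(1) that by auto
  have "spells r' l' (f ` B i) t" if "i \<noteq> 0" for i
    by (rule Power.IH) (use *(2) sub[OF that] that Power.prems(2,3) in blast)+
  moreover have "precedes r' (f ` B i) (f ` B j)" if "(i, j) \<in> omega_plus_omega_star" "i \<noteq> j" for i j
  proof (rule precedes_transfer)
    show "precedes r (B i) (B j)" using *(3) that by blast
    show "(f p, f q) \<in> r' \<and> f p \<noteq> f q" if "p \<in> B i" "q \<in> B j" "(p, q) \<in> r" "p \<noteq> q" for p q
      using that Power.prems(2) sub[of i] sub[of j] \<open>(i, j) \<in> omega_plus_omega_star\<close>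
      unfolding omega_plus_omega_star_def by blast
  qed
  ultimately show ?case using *(1)
    by (auto simp: image_UN intro!: exI[of _ "\<lambda>i. f ` B i"])
qed auto

lemma spells_cong:
  assumes "spells r l A t" "\<And>p q. p \<in> A \<Longrightarrow> q \<in> A \<Longrightarrow> (p, q) \<in> r \<Longrightarrow> p \<noteq> q \<Longrightarrow> (p, q) \<in> r'"
    "\<And>p. p \<in> A \<Longrightarrow> l' p = l p"
  shows "spells r' l' A t"
  using spells_image[of r l A t "\<lambda>p. p" r' l'] assms by simp

lemma spells_converse: "spells r l A t \<Longrightarrow> spells (r\<inverse>) l A (reverse_term t)"
proof (induction t arbitrary: A)
  case (Cat s t)
  then obtain B C where "A = B \<union> C" "precedes r B C" "spells r l B s" "spells r l C t" by auto
  then show ?case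
    using Cat.IH unfolding precedes_def reverse_term.simps spells.simps
    by (intro exI[of _ C] exI[of _ B]) auto
next
  case (Power t)
  then obtain B where *: "A = (\<Union>i\<in>-{0}. B i)" "\<forall>i\<in>-{0::int}. spells r l (B i) t"
    "\<forall>i j. (i, j) \<in> omega_plus_omega_star \<and> i \<noteq> j \<longrightarrow> precedes r (B i) (B j)" by auto
  have "i \<in> uminus ` (- {0})" if "i \<noteq> 0" for i :: int
    using that by (intro image_eqI[of i uminus "- i"]) auto
  then have "- {0::int} = uminus ` (- {0})"
    by auto
  \<comment> \<open>The copies are renumbered by negation, which reverses
    \<open>omega_plus_omega_star\<close>.\<close>
  then have "A = (\<Union>i\<in>-{0}. B (-i))"
    unfolding *(1) by (metis image_image)
  moreover have "precedes (r\<inverse>) (B (-i)) (B (-j))" if "(i, j) \<in> omega_plus_omega_star" "i \<noteq> j" for i j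
  proof -
    have "(-j, -i) \<in> omega_plus_omega_star"
      using that unfolding omega_plus_omega_star_def by (auto split: if_splits)
    then have "precedes r (B (-j)) (B (-i))"
      using *(3) that by simp
    then show ?thesis unfolding precedes_def by auto
  qed
  moreover have "spells (r\<inverse>) l (B (-i)) (reverse_term t)" if "i \<noteq> 0" for i
    using *(2) that by (intro Power.IH) simp
  ultimately show ?case
    by (auto intro!: exI[of _ "\<lambda>i. B (-i)"])
qed auto

text \<open>Also used with the converse order, where it singles out the last position of
  \<open>a\<close>.\<close>

definition is_first :: "'p rel \<Rightarrow> ('p \<Rightarrow> 'a) \<Rightarrow> 'p set \<Rightarrow> 'a \<Rightarrow> 'p \<Rightarrow> bool" where
  "is_first r l A a p \<longleftrightarrow> p \<in> A \<and> l p = a \<and> (\<forall>q \<in> A. l q = a \<longrightarrow> (p, q) \<in> r)"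

text \<open>Accessibility and the description of both factors are proved in one induction, as the
  factors refer to the position found. In \<open>Power t\<close> every copy contains each letter of
  \<open>t\<close>, so the first \<open>a\<close> lies in copy 1.\<close>

lemma spells_first:
  assumes r: "antisym r" "\<And>p. p \<in> A \<Longrightarrow> (p, p) \<in> r" and t: "spells r l A t" "a \<in> letters t"
  shows "\<exists>p. is_first r l A a p \<and>
    spells r l {q \<in> A. (q, p) \<in> r \<and> q \<noteq> p} (term_X_left t a) \<and> spells r l {q \<in> A. (p, q) \<in> r \<and> q \<noteq> p} (term_X_right t a)"
  using t r(2)
proof (induction t arbitrary: A)
  case (Letter b)
  then show ?case by (auto simp: is_first_def)
next
  case (Cat s t)
  then obtain B C where *: "A = B \<union> C" "precedes r B C" "spells r l B s" "spells r l C t" by auto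
  have asym: "(p, q) \<in> r" "(q, p) \<notin> r" "p \<noteq> q" if "p \<in> B" "q \<in> C" for p q
    using *(2) that antisymD[OF r(1)] unfolding precedes_def by blast+
  show ?case
  proof (cases "a \<in> letters s")
    case True
    then obtain p where p: "is_first r l B a p" "spells r l {q \<in> B. (q, p) \<in> r \<and> q \<noteq> p} (term_X_left s a)"
      "spells r l {q \<in> B. (p, q) \<in> r \<and> q \<noteq> p} (term_X_right s a)"
      using Cat.IH(1)[OF *(3)] Cat.prems(3) *(1) by blast
    have pB: "p \<in> B" using p(1) by (simp add: is_first_def)
    have "{q \<in> A. (q, p) \<in> r \<and> q \<noteq> p} = {q \<in> B. (q, p) \<in> r \<and> q \<noteq> p}"
      using asym[OF pB] *(1) by auto
    moreover have "{q \<in> A. (p, q) \<in> r \<and> q \<noteq> p} = {q \<in> B. (p, q) \<in> r \<and> q \<noteq> p} \<union> C"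
      using asym[OF pB] *(1) by auto
    moreover have "precedes r {q \<in> B. (p, q) \<in> r \<and> q \<noteq> p} C"
      using *(2) by (auto simp: precedes_def)
    moreover have "is_first r l A a p"
      using p(1) asym[OF pB] *(1) by (auto simp: is_first_def)
    ultimately show ?thesis
      using p(2,3) *(4) True by (intro exI[of _ p]) auto
  next
    case False
    then obtain p where p: "is_first r l C a p" "spells r l {q \<in> C. (q, p) \<in> r \<and> q \<noteq> p} (term_X_left t a)"
      "spells r l {q \<in> C. (p, q) \<in> r \<and> q \<noteq> p} (term_X_right t a)"
      using Cat.IH(2)[OF *(4)] Cat.prems(2,3) *(1) by fastforce
    have pC: "p \<in> C" using p(1) by (simp add: is_first_def)
    have noB: "l q \<noteq> a" if "q \<in> B" for q
      using letters_spells[OF *(3)] False that by auto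
    have "{q \<in> A. (q, p) \<in> r \<and> q \<noteq> p} = B \<union> {q \<in> C. (q, p) \<in> r \<and> q \<noteq> p}"
      using asym[OF _ pC] *(1) by auto
    moreover have "{q \<in> A. (p, q) \<in> r \<and> q \<noteq> p} = {q \<in> C. (p, q) \<in> r \<and> q \<noteq> p}"
      using asym[OF _ pC] *(1) by auto
    moreover have "precedes r B {q \<in> C. (q, p) \<in> r \<and> q \<noteq> p}"
      using *(2) by (auto simp: precedes_def)
    moreover have "is_first r l A a p"
      using p(1) noB *(1) by (auto simp: is_first_def)
    ultimately show ?thesis
      using p(2,3) *(3) False by (intro exI[of _ p]) auto
  qed
next
  case (Power t)
  then obtain B where *: "A = (\<Union>i\<in>-{0}. B i)" "\<forall>i\<in>-{0::int}. spells r l (B i) t"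
    "\<forall>i j. (i, j) \<in> omega_plus_omega_star \<and> i \<noteq> j \<longrightarrow> precedes r (B i) (B j)" by auto
  have before: "precedes r (B 1) (B i)" if "i \<noteq> 0" "i \<noteq> 1" for i
    using *(3) that by (auto simp: omega_plus_omega_star_def)
  obtain p where p: "is_first r l (B 1) a p" "spells r l {q \<in> B 1. (q, p) \<in> r \<and> q \<noteq> p} (term_X_left t a)"
      "spells r l {q \<in> B 1. (p, q) \<in> r \<and> q \<noteq> p} (term_X_right t a)"
    using Power.IH[of "B 1"] Power.prems(2,3) * by fastforce
  have pB: "p \<in> B 1" using p(1) by (simp add: is_first_def)
  have asym: "(p, q) \<in> r" "(q, p) \<notin> r" "p \<noteq> q" if "q \<in> B i" "i \<noteq> 0" "i \<noteq> 1" for q i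
    using before[OF that(2,3)] that(1) pB antisymD[OF r(1)] unfolding precedes_def by blast+
  define C where "C = (\<Union>i\<in>-{0,1}. B i)"
  have A: "A = B 1 \<union> C" proof -
    have "- {0::int} = insert 1 (- {0, 1})" by auto
    then show ?thesis unfolding *(1) C_def by (metis UN_insert)
  qed
  have asymC: "(p, q) \<in> r" "(q, p) \<notin> r" "p \<noteq> q" if "q \<in> C" for q
    using asym that unfolding C_def by blast+
  \<comment> \<open>Raising the positive indices by one and keeping the negative ones is an order
    isomorphism from the indices of all copies onto those of the copies other than the
    first.\<close>
  define D where "D i = B (if i > 0 then i + 1 else i)" for i
  have "spells r l C (Power t)"
    unfolding spells.simps
  proof (intro exI[of _ D] conjI allI impI)
    show "C = (\<Union>i\<in>-{0}. D i)"
    proof (intro equalityI subsetI)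
      fix x assume "x \<in> C"
      then obtain i where i: "x \<in> B i" "i \<noteq> 0" "i \<noteq> 1" by (auto simp: C_def)
      show "x \<in> (\<Union>i\<in>-{0}. D i)"
      proof (cases "i > 0")
        case True
        then have "x \<in> D (i - 1)" using i by (simp add: D_def)
        then show ?thesis using i by auto
      next
        case False
        then have "x \<in> D i" using i by (simp add: D_def)
        then show ?thesis using i by auto
      qed
    next
      fix x assume "x \<in> (\<Union>i\<in>-{0}. D i)"
      then obtain i where "x \<in> D i" "i \<noteq> 0" by auto
      then show "x \<in> C"
        unfolding C_def D_def by (intro UN_I[of "if i > 0 then i + 1 else i"]) auto
    qed
    show "precedes r (D i) (D j)" if "(i, j) \<in> omega_plus_omega_star \<and> i \<noteq> j" for i j
      unfolding D_def using that
      by (intro *(3)[rule_format]) (auto simp: omega_plus_omega_star_def split: if_splits)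
    show "\<forall>i\<in>-{0}. spells r l (D i) t"
      unfolding D_def using *(2) by auto
  qed
  moreover have "{q \<in> A. (q, p) \<in> r \<and> q \<noteq> p} = {q \<in> B 1. (q, p) \<in> r \<and> q \<noteq> p}"
    using asymC A by auto
  moreover have "{q \<in> A. (p, q) \<in> r \<and> q \<noteq> p} = {q \<in> B 1. (p, q) \<in> r \<and> q \<noteq> p} \<union> C"
    using asymC A by auto
  moreover have "precedes r {q \<in> B 1. (p, q) \<in> r \<and> q \<noteq> p} C"
    using before by (auto simp: precedes_def C_def)
  moreover have "is_first r l A a p"
    using p(1) asymC A by (auto simp: is_first_def)
  ultimately show ?case
    using p(2,3) by (intro exI[of _ p]) auto
qed auto

text \<open>The last \<open>a\<close> is the first one for the converse order, in which the same set
  spells the reversed term. \<open>spells_first\<close> applies there, and reversing twice returns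
  to the original term.\<close>

lemma spells_last:
  assumes r: "antisym r" "\<And>p. p \<in> A \<Longrightarrow> (p, p) \<in> r" and t: "spells r l A t" "a \<in> letters t"
  shows "\<exists>p. is_first (r\<inverse>) l A a p \<and>
    spells r l {q \<in> A. (q, p) \<in> r \<and> q \<noteq> p} (term_Y_left t a) \<and> spells r l {q \<in> A. (p, q) \<in> r \<and> q \<noteq> p} (term_Y_right t a)"
proof -
  obtain p where "is_first (r\<inverse>) l A a p"
    "spells (r\<inverse>) l {q \<in> A. (q, p) \<in> r\<inverse> \<and> q \<noteq> p} (reverse_term (term_Y_right t a))"
    "spells (r\<inverse>) l {q \<in> A. (p, q) \<in> r\<inverse> \<and> q \<noteq> p} (reverse_term (term_Y_left t a))"
    using spells_first[of "r\<inverse>" A l "reverse_term t" a] spells_converse[OF t(1)] r t(2)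
    by (auto simp: term_X_left_reverse term_X_right_reverse)
  moreover from this(2,3)[THEN spells_converse] have "spells r l {q \<in> A. (p, q) \<in> r \<and> q \<noteq> p} (term_Y_right t a)"
    "spells r l {q \<in> A. (q, p) \<in> r \<and> q \<noteq> p} (term_Y_left t a)"
    by simp_all
  ultimately show ?thesis by blast
qed

section \<open>Interpretations\<close>

lemma Linear_order_iff:
  "Linear_order r \<longleftrightarrow> (\<forall>p\<in>Field r. (p, p) \<in> r) \<and> trans r \<and> antisym r \<and>
     (\<forall>p\<in>Field r. \<forall>q\<in>Field r. (p, q) \<in> r \<or> (q, p) \<in> r)"
  by (auto simp: order_on_defs refl_on_def total_on_def FieldI1 FieldI2; metis)

lemma Linear_order_omega: "Linear_order omega_plus_omega_star"
  and Field_omega: "Field omega_plus_omega_star = - {0}"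
proof -
  show F: "Field omega_plus_omega_star = - {0}"
    by (force simp: Field_def omega_plus_omega_star_def)
  show "Linear_order omega_plus_omega_star"
    unfolding Linear_order_iff unfolding F
    by (auto simp: omega_plus_omega_star_def trans_def antisym_def split: if_splits)
qed

lemma ord_grename: "ord (grename f w) = map_prod f f ` ord w"
  by (force simp: grename_def)

lemma positions_grename: "positions (grename f w) = f ` positions w"
  by (force simp: ord_grename Field_def)

lemma Linear_order_grename:
  assumes "Linear_order (ord w)" "inj f"
  shows "Linear_order (ord (grename f w))"
proof -
  have mem: "(f p, f q) \<in> ord (grename f w) \<longleftrightarrow> (p, q) \<in> ord w" for p q
    using injD[OF assms(2)] by (auto simp: ord_grename)
  have "trans (ord (grename f w))"
  proof (rule transI)
    fix x y z assume "(x, y) \<in> ord (grename f w)" "(y, z) \<in> ord (grename f w)"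
    moreover from this obtain p q s where "x = f p" "y = f q" "z = f s"
      by (auto simp: ord_grename)
    ultimately show "(x, z) \<in> ord (grename f w)"
      using assms(1) mem by (auto simp: Linear_order_iff dest: transD)
  qed
  moreover have "antisym (ord (grename f w))"
  proof (rule antisymI)
    fix x y assume "(x, y) \<in> ord (grename f w)" "(y, x) \<in> ord (grename f w)"
    moreover from this obtain p q where "x = f p" "y = f q"
      by (auto simp: ord_grename)
    ultimately show "x = y"
      using assms(1) mem by (auto simp: Linear_order_iff dest: antisymD)
  qed
  ultimately show ?thesis
    using assms(1) unfolding Linear_order_iff unfolding positions_grename by (auto simp: mem)
qed

lemma positions_gconcat: "positions (gconcat u v) = Inl ` positions u \<union> Inr ` positions v"
  by (force simp: gconcat_def Field_def)

lemma Linear_order_gconcat: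
  assumes "Linear_order (ord u)" "Linear_order (ord v)"
  shows "Linear_order (ord (gconcat u v))"
proof -
  note u = assms(1)[unfolded Linear_order_iff] and v = assms(2)[unfolded Linear_order_iff]
  have mem: "(Inl p, Inl p') \<in> ord (gconcat u v) \<longleftrightarrow> (p, p') \<in> ord u"
    "(Inr q, Inr q') \<in> ord (gconcat u v) \<longleftrightarrow> (q, q') \<in> ord v"
    "(Inl p, Inr q) \<in> ord (gconcat u v) \<longleftrightarrow> p \<in> positions u \<and> q \<in> positions v"
    "(Inr q, Inl p) \<notin> ord (gconcat u v)" for p p' q q'
    by (auto simp: gconcat_def)
  have "trans (ord (gconcat u v))"
  proof (rule transI)
    fix x y z assume "(x, y) \<in> ord (gconcat u v)" "(y, z) \<in> ord (gconcat u v)"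
    then show "(x, z) \<in> ord (gconcat u v)"
      using u v by (cases x; cases y; cases z) (auto simp: mem intro: FieldI1 FieldI2 dest: transD)
  qed
  moreover have "antisym (ord (gconcat u v))"
  proof (rule antisymI)
    fix x y assume "(x, y) \<in> ord (gconcat u v)" "(y, x) \<in> ord (gconcat u v)"
    then show "x = y"
      using u v by (cases x; cases y) (auto simp: mem dest: antisymD)
  qed
  ultimately show ?thesis
    using u v unfolding Linear_order_iff unfolding positions_gconcat by (auto simp: mem; blast)
qed

lemma positions_gpower:
  assumes "Linear_order (ord w)" "Linear_order \<nu>"
  shows "positions (gpower w \<nu>) = positions w \<times> Field \<nu>"
proof
  show "positions (gpower w \<nu>) \<subseteq> positions w \<times> Field \<nu>"
    by (auto simp: gpower_def Field_def)
  have "(p, q) \<in> positions (gpower w \<nu>)" if "p \<in> positions w" "q \<in> Field \<nu>" for p q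
    using that assms unfolding Linear_order_iff
    by (intro FieldI1[of _ "(p, q)"]) (auto simp: gpower_def)
  then show "positions w \<times> Field \<nu> \<subseteq> positions (gpower w \<nu>)"
    by auto
qed

lemma Linear_order_gpower:
  assumes "Linear_order (ord w)" "Linear_order \<nu>"
  shows "Linear_order (ord (gpower w \<nu>))"
proof -
  note w = assms(1)[unfolded Linear_order_iff] and \<nu> = assms(2)[unfolded Linear_order_iff]
  have mem: "((p, q), (p', q')) \<in> ord (gpower w \<nu>) \<longleftrightarrow>
    p \<in> positions w \<and> p' \<in> positions w \<and> (q, q') \<in> \<nu> \<and> (q = q' \<longrightarrow> (p, p') \<in> ord w)" for p q p' q'
    by (auto simp: gpower_def)
  have "trans (ord (gpower w \<nu>))"
    unfolding trans_def split_paired_All mem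
    using transD[of "ord w"] transD[of \<nu>] antisymD[of \<nu>] w \<nu> by metis
  moreover have "antisym (ord (gpower w \<nu>))"
    unfolding antisym_def split_paired_All mem
    using antisymD[of "ord w"] antisymD[of \<nu>] w \<nu> by metis
  ultimately show ?thesis
    unfolding Linear_order_iff unfolding positions_gpower[OF assms] using w \<nu> by (auto simp: mem)
qed

lemma lab_grename: "inj f \<Longrightarrow> lab (grename f w) (f p) = lab w p"
  by (simp add: grename_def)

lemma inj_case_sum_pos: "inj (case_sum InL InR)"
  by (auto simp: inj_def split: sum.splits)

lemma inj_case_prod_Copy: "inj (case_prod Copy)"
  by (auto simp: inj_def)

lemma Linear_order_interp: "Linear_order (ord (interp omega_plus_omega_star t))"
proof (induction t)
  case Eps
  show ?case by (simp add: gempty_def Linear_order_iff trans_def)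
next
  case (Letter a)
  show ?case by (simp add: gsingle_def Linear_order_iff trans_def antisym_def)
qed (simp_all add: Linear_order_grename Linear_order_gconcat Linear_order_gpower
    Linear_order_omega inj_case_sum_pos inj_case_prod_Copy)

text \<open>The pieces demanded by \<open>spells\<close> are the images of the subterms' positions
  under \<open>InL\<close>, \<open>InR\<close> and \<open>Copy\<close>, to which
  \<open>spells_image\<close> carries the induction hypotheses.\<close>

lemma spells_interp:
  "spells (ord (interp omega_plus_omega_star t)) (lab (interp omega_plus_omega_star t))
     (positions (interp omega_plus_omega_star t)) t"
proof (induction t)
  case Eps
  show ?case by (simp add: gempty_def)
next
  case (Letter a)
  show ?case by (simp add: gsingle_def)
next
  case (Cat s t)
  let ?u = "interp omega_plus_omega_star s" and ?v = "interp omega_plus_omega_star t"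
    and ?w = "interp omega_plus_omega_star (Cat s t)"
  have lab: "lab ?w (InL p) = lab ?u p" "lab ?w (InR q) = lab ?v q" for p q
    using lab_grename[OF inj_case_sum_pos, of "gconcat ?u ?v" "Inl p"]
      lab_grename[OF inj_case_sum_pos, of "gconcat ?u ?v" "Inr q"] by (simp_all add: gconcat_def)
  have ord: "(p, p') \<in> ord ?u \<Longrightarrow> (InL p, InL p') \<in> ord ?w" "(q, q') \<in> ord ?v \<Longrightarrow> (InR q, InR q') \<in> ord ?w"
    "p \<in> positions ?u \<Longrightarrow> q \<in> positions ?v \<Longrightarrow> (InL p, InR q) \<in> ord ?w" for p p' q q'
    using imageI[of "(Inl p, Inl p')" "ord (gconcat ?u ?v)" "map_prod (case_sum InL InR) (case_sum InL InR)"]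
      imageI[of "(Inr q, Inr q')" "ord (gconcat ?u ?v)" "map_prod (case_sum InL InR) (case_sum InL InR)"]
      imageI[of "(Inl p, Inr q)" "ord (gconcat ?u ?v)" "map_prod (case_sum InL InR) (case_sum InL InR)"]
    by (simp_all add: ord_grename) (simp_all add: gconcat_def)
  have "spells (ord ?w) (lab ?w) (InL ` positions ?u) s" "spells (ord ?w) (lab ?w) (InR ` positions ?v) t"
    by (rule spells_image[OF Cat.IH(1)] spells_image[OF Cat.IH(2)]; simp add: ord lab del: interp.simps)+
  moreover have "positions ?w = InL ` positions ?u \<union> InR ` positions ?v"
    by (simp add: positions_grename positions_gconcat image_Un image_image)
  moreover have "precedes (ord ?w) (InL ` positions ?u) (InR ` positions ?v)"
    unfolding precedes_def using ord(3) by blast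
  ultimately show ?case
    unfolding spells.simps by blast
next
  case (Power t)
  let ?u = "interp omega_plus_omega_star t" and ?w = "interp omega_plus_omega_star (Power t)"
  have lab: "lab ?w (Copy p i) = lab ?u p" for p i
    using lab_grename[OF inj_case_prod_Copy, of "gpower ?u omega_plus_omega_star" "(p, i)"]
    by (simp add: gpower_def)
  have ord: "(Copy p i, Copy p' j) \<in> ord ?w" if "p \<in> positions ?u" "p' \<in> positions ?u"
    "(i, j) \<in> omega_plus_omega_star" "i = j \<longrightarrow> (p, p') \<in> ord ?u" for p p' i j
  proof -
    have "((p, i), (p', j)) \<in> ord (gpower ?u omega_plus_omega_star)"
      using that by (simp add: gpower_def)
    from imageI[OF this, of "map_prod (case_prod Copy) (case_prod Copy)"] show ?thesis
      by (simp add: ord_grename)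
  qed
  have refl: "(i, i) \<in> omega_plus_omega_star" if "i \<noteq> 0" for i
    using that by (simp add: omega_plus_omega_star_def)
  have "spells (ord ?w) (lab ?w) ((\<lambda>p. Copy p i) ` positions ?u) t" if "i \<noteq> 0" for i
    by (rule spells_image[OF Power.IH]) (use refl[OF that] in \<open>simp_all add: ord lab FieldI1 FieldI2 del: interp.simps\<close>)
  moreover have "positions ?w = (\<Union>i\<in>-{0}. (\<lambda>p. Copy p i) ` positions ?u)"
    using positions_gpower[OF Linear_order_interp[of t] Linear_order_omega]
    by (force simp: positions_grename Field_omega)
  moreover have "precedes (ord ?w) ((\<lambda>p. Copy p i) ` positions ?u) ((\<lambda>p. Copy p j) ` positions ?u)"
    if "(i, j) \<in> omega_plus_omega_star" "i \<noteq> j" for i j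
    unfolding precedes_def using that by (auto intro!: ord simp del: interp.simps)
  ultimately show ?case
    unfolding spells.simps by blast
qed

section \<open>Factors of words\<close>

text \<open>The word keeps its own letters while the term is written in their numbers under
  \<open>c\<close>, which is all that the decision procedure sees. Injectivity is required on a
  common alphabet \<open>S\<close> so that alphabets of two words can be compared through
  \<open>c\<close>.\<close>

definition represents :: "'a set \<Rightarrow> ('a \<Rightarrow> 'b) \<Rightarrow> ('p, 'a) gword \<Rightarrow> 'b pi_term \<Rightarrow> bool" where
  "represents S c w t \<longleftrightarrow> Linear_order (ord w) \<and> inj_on c S \<and> alph w \<subseteq> S \<and>
     spells (ord w) (c \<circ> lab w) (positions w) t"

lemma letters_represents: "represents S c w t \<Longrightarrow> letters t = c ` alph w"
  using letters_spells[of "ord w" "c \<circ> lab w" "positions w" t]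
  by (simp add: represents_def alph_def image_image)

lemma ord_factor [simp]: "ord (factor w P) = Restr (ord w) P"
  and lab_factor [simp]: "lab (factor w P) = lab w"
  by (simp_all add: factor_def)

lemma positions_factor:
  "Linear_order (ord w) \<Longrightarrow> positions (factor w P) = positions w \<inter> P"
  by (simp add: Refl_Field_Restr order_on_defs)

lemma represents_factor:
  assumes "represents S c w t" "spells (ord w) (c \<circ> lab w) P u" "P \<subseteq> positions w"
  shows "represents S c (factor w P) u"
proof -
  have lin: "Linear_order (ord w)" using assms(1) by (simp add: represents_def)
  have "positions (factor w P) = P"
    using positions_factor[OF lin] assms(3) by blast
  moreover have "alph (factor w P) \<subseteq> alph w"
    using assms(3) calculation by (auto simp: alph_def)
  moreover have "spells (Restr (ord w) P) (c \<circ> lab w) P u"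
    by (rule spells_cong[OF assms(2)]) auto
  ultimately show ?thesis
    using assms(1) Linear_order_Restr[OF lin, of P] unfolding represents_def ord_factor lab_factor
    by (metis subset_trans)
qed

lemma first_pos_eqI:
  assumes "Linear_order (ord w)" "is_first (ord w) (lab w) (positions w) a p"
  shows "first_pos w a = p"
  unfolding first_pos_def using assms
  by (intro the_equality) (auto simp: is_first_def Linear_order_iff dest: antisymD)

lemma last_pos_eqI:
  assumes "Linear_order (ord w)" "is_first ((ord w)\<inverse>) (lab w) (positions w) a p"
  shows "last_pos w a = p"
  unfolding last_pos_def using assms
  by (intro the_equality) (auto simp: is_first_def Linear_order_iff dest: antisymD)

lemma is_first_relabel:
  assumes "inj_on c (alph w)" "a \<in> alph w"
  shows "is_first r (c \<circ> lab w) (positions w) (c a) p \<longleftrightarrow> is_first r (lab w) (positions w) a p"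
proof -
  have "c (lab w q) = c a \<longleftrightarrow> lab w q = a" if "q \<in> positions w" for q
    using assms that by (auto simp: alph_def dest: inj_onD)
  then show ?thesis unfolding is_first_def by auto
qed

lemma less_sets:
  "{q. gless w q p} = {q \<in> positions w. (q, p) \<in> ord w \<and> q \<noteq> p}"
    "{q. gless w p q} = {q \<in> positions w. (p, q) \<in> ord w \<and> q \<noteq> p}"
  by (auto simp: gless_def Field_def)

text \<open>The first conclusion says that the definite description \<open>first_pos\<close> denotes
  what it should. Being represented by a term thus takes the place of accessibility and is inherited
  by the factors.\<close>

lemma represents_first:
  assumes w: "represents S c w t" and a: "a \<in> alph w"
  shows "is_first (ord w) (lab w) (positions w) a (first_pos w a)"
    "represents S c (X_left w a) (term_X_left t (c a))" "represents S c (X_right w a) (term_X_right t (c a))"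
proof -
  have lin: "Linear_order (ord w)" and inj: "inj_on c (alph w)"
    and spells: "spells (ord w) (c \<circ> lab w) (positions w) t"
    using w by (auto simp: represents_def intro: inj_on_subset)
  have "c a \<in> letters t" using letters_represents[OF w] a by simp
  then obtain p where p: "is_first (ord w) (c \<circ> lab w) (positions w) (c a) p"
    "spells (ord w) (c \<circ> lab w) {q \<in> positions w. (q, p) \<in> ord w \<and> q \<noteq> p} (term_X_left t (c a))"
    "spells (ord w) (c \<circ> lab w) {q \<in> positions w. (p, q) \<in> ord w \<and> q \<noteq> p} (term_X_right t (c a))"
    using spells_first[OF _ _ spells] lin unfolding Linear_order_iff by blast
  have first: "is_first (ord w) (lab w) (positions w) a p"
    using p(1) is_first_relabel[OF inj a] by simp
  then have pos: "first_pos w a = p"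
    by (rule first_pos_eqI[OF lin])
  show "is_first (ord w) (lab w) (positions w) a (first_pos w a)"
    using first pos by simp
  show "represents S c (X_left w a) (term_X_left t (c a))" "represents S c (X_right w a) (term_X_right t (c a))"
    unfolding X_left_def X_right_def pos less_sets
    by (rule represents_factor[OF w p(2)] represents_factor[OF w p(3)]; blast)+
qed

lemma represents_last:
  assumes w: "represents S c w t" and a: "a \<in> alph w"
  shows "is_first ((ord w)\<inverse>) (lab w) (positions w) a (last_pos w a)"
    "represents S c (Y_left w a) (term_Y_left t (c a))" "represents S c (Y_right w a) (term_Y_right t (c a))"
proof -
  have lin: "Linear_order (ord w)" and inj: "inj_on c (alph w)"
    and spells: "spells (ord w) (c \<circ> lab w) (positions w) t"
    using w by (auto simp: represents_def intro: inj_on_subset)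
  have "c a \<in> letters t" using letters_represents[OF w] a by simp
  then obtain p where p: "is_first ((ord w)\<inverse>) (c \<circ> lab w) (positions w) (c a) p"
    "spells (ord w) (c \<circ> lab w) {q \<in> positions w. (q, p) \<in> ord w \<and> q \<noteq> p} (term_Y_left t (c a))"
    "spells (ord w) (c \<circ> lab w) {q \<in> positions w. (p, q) \<in> ord w \<and> q \<noteq> p} (term_Y_right t (c a))"
    using spells_last[OF _ _ spells] lin unfolding Linear_order_iff by blast
  have last: "is_first ((ord w)\<inverse>) (lab w) (positions w) a p"
    using p(1) is_first_relabel[OF inj a] by simp
  then have pos: "last_pos w a = p"
    by (rule last_pos_eqI[OF lin])
  show "is_first ((ord w)\<inverse>) (lab w) (positions w) a (last_pos w a)"
    using last pos by simp
  show "represents S c (Y_left w a) (term_Y_left t (c a))" "represents S c (Y_right w a) (term_Y_right t (c a))"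
    unfolding Y_left_def Y_right_def pos less_sets
    by (rule represents_factor[OF w p(2)] represents_factor[OF w p(3)]; blast)+
qed

lemma C_defined_iff:
  assumes w: "represents S c w t" and a: "a \<in> alph w" and b: "b \<in> alph w"
  shows "C_defined w a b \<longleftrightarrow> term_C_defined t (c a) (c b)"
proof -
  have lin: "Linear_order (ord w)" and inj: "inj_on c (alph w)"
    using w by (auto simp: represents_def intro: inj_on_subset)
  note L = lin[unfolded Linear_order_iff]
  let ?p = "first_pos w a" and ?q = "last_pos w b"
  have p: "?p \<in> positions w" "lab w ?p = a" "\<And>q. q \<in> positions w \<Longrightarrow> lab w q = a \<Longrightarrow> (?p, q) \<in> ord w"
    using represents_first(1)[OF w a] by (auto simp: is_first_def)
  have q: "?q \<in> positions w" "lab w ?q = b" "\<And>p. p \<in> positions w \<Longrightarrow> lab w p = b \<Longrightarrow> (p, ?q) \<in> ord w"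
    using represents_last(1)[OF w b] by (auto simp: is_first_def)
  have sub: "{q. gless w q ?q} \<subseteq> positions w"
    by (auto simp: gless_def Field_def)
  then have alph: "alph (Y_left w b) = lab w ` {q. gless w q ?q}"
    using positions_factor[OF lin, of "{q. gless w q ?q}"]
    unfolding alph_def Y_left_def by (simp add: inf.absorb2)
  have "c a \<in> letters (term_Y_left t (c b)) \<longleftrightarrow> a \<in> alph (Y_left w b)"
  proof -
    have "alph (Y_left w b) \<subseteq> alph w" unfolding alph using sub by (auto simp: alph_def)
    then show ?thesis
      using letters_represents[OF represents_last(2)[OF w b]] inj a by (auto dest: inj_onD)
  qed
  moreover have "c a = c b \<longleftrightarrow> a = b"
    using inj a b by (auto dest: inj_onD)
  moreover have "C_defined w a b \<longleftrightarrow> a \<noteq> b \<and> a \<notin> alph (Y_left w b)"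
  proof
    assume C: "C_defined w a b"
    then have "(?q, ?p) \<in> ord w" "?p \<noteq> ?q" by (auto simp: C_defined_def gless_def)
    moreover have False if "gless w r ?q" "lab w r = a" for r
      using that p(3)[of r] sub calculation L unfolding gless_def
      by (metis (no_types, lifting) FieldI1 antisymD transD)
    moreover have "a \<noteq> b"
      using p q calculation L by (metis antisymD)
    ultimately show "a \<noteq> b \<and> a \<notin> alph (Y_left w b)" unfolding alph by auto
  next
    assume R: "a \<noteq> b \<and> a \<notin> alph (Y_left w b)"
    then have "?p \<noteq> ?q" using p q by auto
    moreover have "\<not> gless w ?p ?q"
      using R p(2) alph by (metis image_eqI mem_Collect_eq)
    ultimately show "C_defined w a b"
      using L p(1) q(1) unfolding C_defined_def gless_def by metis
  qed
  ultimately show ?thesis unfolding term_C_defined_def by simp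
qed

lemma represents_C:
  assumes w: "represents S c w t" and a: "a \<in> alph w" and b: "b \<in> alph w" and C: "C_defined w a b"
  shows "represents S c (C_factor w a b) (term_C t (c a) (c b))"
proof -
  have lin: "Linear_order (ord w)" using w by (simp add: represents_def)
  note L = lin[unfolded Linear_order_iff]
  let ?p = "first_pos w a" and ?q = "last_pos w b" and ?v = "Y_right w b"
  have v: "represents S c ?v (term_Y_right t (c b))" by (rule represents_last(3)[OF w b])
  then have linv: "Linear_order (ord ?v)" by (simp add: represents_def)
  have posv: "positions ?v = {q. gless w ?q q}"
  proof -
    have "{q. gless w ?q q} \<subseteq> positions w"
      by (auto simp: gless_def Field_def)
    then show ?thesis
      unfolding Y_right_def by (simp only: positions_factor[OF lin] inf.absorb2)
  qed
  have p: "?p \<in> positions w" "lab w ?p = a" "\<And>q. q \<in> positions w \<Longrightarrow> lab w q = a \<Longrightarrow> (?p, q) \<in> ord w"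
    using represents_first(1)[OF w a] by (auto simp: is_first_def)
  have pv: "?p \<in> positions ?v" using C unfolding posv C_defined_def by simp
  have "is_first (ord ?v) (lab ?v) (positions ?v) a ?p"
    using pv p unfolding is_first_def posv by (auto simp: Y_right_def gless_def Field_def)
  then have first: "first_pos ?v a = ?p" by (rule first_pos_eqI[OF linv])
  have "a \<in> alph ?v"
    unfolding alph_def using pv p(2) by (intro image_eqI[of _ _ ?p]) (simp_all add: Y_right_def)
  from represents_first(2)[OF v this]
  have "represents S c (X_left ?v a) (term_C t (c a) (c b))" unfolding term_C_def .
  moreover have "X_left ?v a = C_factor w a b"
  proof -
    have "{p. gless ?v p ?p} = {p. gless w ?q p \<and> gless w p ?p}"
      using pv unfolding posv by (auto simp: Y_right_def gless_def)
    moreover have "Restr (Restr (ord w) {p. gless w ?q p}) {p. gless w ?q p \<and> gless w p ?p}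
      = Restr (ord w) {p. gless w ?q p \<and> gless w p ?p}" by auto
    ultimately show ?thesis
      unfolding X_left_def C_factor_def first by (simp add: factor_def Y_right_def)
  qed
  ultimately show ?thesis by simp
qed

section \<open>The transition system\<close>

text \<open>
  A state consists of a level, a kind and two terms. The kinds are \<open>0\<close> for \<open>X\<close>, \<open>1\<close> for \<open>Y\<close>
  and anything larger for \<open>WI\<close>. The level is \<open>Suc m\<close> for the relations with first index \<open>m\<close>
  and \<open>0\<close> if \<open>m\<close> is infinite, so that truncated subtraction of \<open>1\<close> lowers it in both cases;
  level \<open>1\<close> is final.
  A move \<open>(d, a, b)\<close> passes to the same words (\<open>d = 0\<close>) or to their factors given by
  \<open>X\<^sup>L\<close>, \<open>X\<^sup>R\<close>, \<open>Y\<^sup>L\<close>, \<open>Y\<^sup>R\<close>, \<open>C\<close> (\<open>d = 1, \<dots>, 5\<close>).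
\<close>

type_synonym 'a state = "nat \<times> nat \<times> 'a pi_term \<times> 'a pi_term"

text \<open>Moves have to be total, so an illegal one leads to this absorbing state, which passes
  the test because its level is final.\<close>

definition dead :: "'a state" where
  "dead = (1, 0, Eps, Eps)"

definition term_factor :: "nat \<Rightarrow> 'a \<Rightarrow> 'a \<Rightarrow> 'a pi_term \<Rightarrow> 'a pi_term" where
  "term_factor d a b t =
     (if d = 0 then t else if d = 1 then term_X_left t a else if d = 2 then term_X_right t a
      else if d = 3 then term_Y_left t a else if d = 4 then term_Y_right t a else term_C t a b)"

text \<open>Move 0 stands for the clause of \<open>X\<close> that demands \<open>Y\<close> with
  lowered indices on the same words, and vice versa; \<open>WI\<close> has no such clause. The
  letter \<open>b\<close> matters only for move 5.\<close>

definition term_legal :: "nat \<Rightarrow> 'a pi_term \<Rightarrow> nat \<Rightarrow> 'a \<Rightarrow> 'a \<Rightarrow> bool" where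
  "term_legal k t d a b \<longleftrightarrow>
     (if d = 0 then k < 2
      else a \<in> letters t \<and>
        (if k = 0 then d = 1 \<or> d = 2 else if k = 1 then d = 3 \<or> d = 4
         else d < 5 \<or> d = 5 \<and> b \<in> letters t \<and> term_C_defined t a b))"

text \<open>These are the right factor at a first position and the left factor at a last position,
  the clauses that leave the first index and the kind unchanged.\<close>

definition keeps :: "nat \<Rightarrow> bool" where "keeps d \<longleftrightarrow> d = 2 \<or> d = 3"

definition new_kind :: "nat \<Rightarrow> nat \<Rightarrow> nat" where
  "new_kind k d = (if 2 \<le> k \<or> keeps d then k else 1 - k)"

fun step :: "'a state \<Rightarrow> nat \<times> 'a \<times> 'a \<Rightarrow> 'a state" where
  "step (c, k, t, u) (d, a, b) =
     (if c \<noteq> 1 \<and> term_legal k t d a b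
      then (if keeps d then c else c - 1, new_kind k d, term_factor d a b t, term_factor d a b u)
      else dead)"

fun ok :: "'a state \<Rightarrow> bool" where
  "ok (c, k, t, u) \<longleftrightarrow> c = 1 \<or> letters t = letters u \<and>
     (2 \<le> k \<longrightarrow> (\<forall>a\<in>letters t. \<forall>b\<in>letters t. term_C_defined t a b \<longleftrightarrow> term_C_defined u a b))"

definition good :: "'a state \<Rightarrow> bool" where
  "good s \<longleftrightarrow> (\<forall>ms. ok (foldl step s ms))"

lemma good_ok: "good s \<Longrightarrow> ok s"
  unfolding good_def by (metis foldl_Nil)

lemma good_step: "good s \<Longrightarrow> good (step s x)"
  unfolding good_def by (metis foldl_Cons)

definition word_factor :: "nat \<Rightarrow> 'a \<Rightarrow> 'a \<Rightarrow> ('p, 'a) gword \<Rightarrow> ('p, 'a) gword" where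
  "word_factor d a b w =
     (if d = 0 then w else if d = 1 then X_left w a else if d = 2 then X_right w a
      else if d = 3 then Y_left w a else if d = 4 then Y_right w a else C_factor w a b)"

definition word_legal :: "nat \<Rightarrow> ('p, 'a) gword \<Rightarrow> nat \<Rightarrow> 'a \<Rightarrow> 'a \<Rightarrow> bool" where
  "word_legal k w d a b \<longleftrightarrow>
     (if d = 0 then k < 2
      else a \<in> alph w \<and>
        (if k = 0 then d = 1 \<or> d = 2 else if k = 1 then d = 3 \<or> d = 4
         else d < 5 \<or> d = 5 \<and> b \<in> alph w \<and> C_defined w a b))"

definition eq_kind :: "nat \<Rightarrow> nat \<Rightarrow> nat \<Rightarrow> ('p, 'a) gword \<Rightarrow> ('p, 'a) gword \<Rightarrow> bool" where
  "eq_kind k m n w v = (if k = 0 then eqX m n w v else if k = 1 then eqY m n w v else eqWI m n w v)"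

lemma eq_kind_0 [simp]: "eq_kind k 0 n w v" "eq_kind k m 0 w v"
  by (cases m; auto simp: eq_kind_def)+

text \<open>The three recursive definitions are brought into the common shape of a local test
  followed by all legal moves, so that the correspondence with \<open>step\<close> is proved once
  for all kinds.\<close>

lemma eq_kind_Suc:
  "eq_kind k (Suc m) (Suc n) w v \<longleftrightarrow> alph w = alph v \<and>
     (2 \<le> k \<longrightarrow> (\<forall>a\<in>alph w. \<forall>b\<in>alph w. C_defined w a b \<longleftrightarrow> C_defined v a b)) \<and>
     (\<forall>d a b. word_legal k w d a b \<longrightarrow>
        eq_kind (new_kind k d) (if keeps d then Suc m else m) n (word_factor d a b w) (word_factor d a b v))"
proof -
  consider "k = 0" | "k = 1" | "k \<ge> 2" by linarith
  then show ?thesis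
  proof cases
    case 1
    have "(\<forall>d a b. word_legal k w d a b \<longrightarrow> P d a b) \<longleftrightarrow>
      (\<forall>a b. P 0 a b) \<and> (\<forall>a\<in>alph w. \<forall>b. P 1 a b \<and> P 2 a b)" for P
      using 1 by (auto simp: word_legal_def)
    then show ?thesis
      using 1 by (simp add: eq_kind_def word_factor_def new_kind_def keeps_def)
  next
    case 2
    have "(\<forall>d a b. word_legal k w d a b \<longrightarrow> P d a b) \<longleftrightarrow>
      (\<forall>a b. P 0 a b) \<and> (\<forall>a\<in>alph w. \<forall>b. P 3 a b \<and> P 4 a b)" for P
      using 2 by (auto simp: word_legal_def)
    then show ?thesis
      using 2 by (simp add: eq_kind_def word_factor_def new_kind_def keeps_def)
  next
    case 3
    have legal: "word_legal k w d a b \<longleftrightarrow> d \<in> {1, 2, 3, 4} \<and> a \<in> alph w \<or>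
        d = 5 \<and> a \<in> alph w \<and> b \<in> alph w \<and> C_defined w a b" for d a b
      using 3 by (auto simp: word_legal_def)
    have "(\<forall>d a b. word_legal k w d a b \<longrightarrow>
        eq_kind (new_kind k d) (if keeps d then Suc m else m) n (word_factor d a b w) (word_factor d a b v)) \<longleftrightarrow>
      (\<forall>a\<in>alph w. eqWI m n (X_left w a) (X_left v a) \<and> eqWI (Suc m) n (X_right w a) (X_right v a) \<and>
         eqWI (Suc m) n (Y_left w a) (Y_left v a) \<and> eqWI m n (Y_right w a) (Y_right v a)) \<and>
      (\<forall>a\<in>alph w. \<forall>b\<in>alph w. C_defined w a b \<longrightarrow> eqWI m n (C_factor w a b) (C_factor v a b))"
      (is "(\<forall>d a b. ?L d a b \<longrightarrow> ?E d a b) \<longleftrightarrow> _")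
    proof -
      have "(\<forall>d a b. ?L d a b \<longrightarrow> ?E d a b) \<longleftrightarrow>
        (\<forall>a\<in>alph w. \<forall>b. ?E 1 a b \<and> ?E 2 a b \<and> ?E 3 a b \<and> ?E 4 a b) \<and>
        (\<forall>a\<in>alph w. \<forall>b\<in>alph w. C_defined w a b \<longrightarrow> ?E 5 a b)"
        unfolding legal by blast
      then show ?thesis
        using 3 by (simp add: eq_kind_def word_factor_def new_kind_def keeps_def)
    qed
    then show ?thesis
      using 3 by (auto simp: eq_kind_def)
  qed
qed

lemma eq_kind_step:
  assumes "eq_kind k (Suc m) (Suc n) w v" "word_legal k w d a b"
  shows "eq_kind (new_kind k d) (if keeps d then Suc m else m) n (word_factor d a b w) (word_factor d a b v)"
  using assms unfolding eq_kind_Suc by blast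

lemma represents_word_factor:
  assumes w: "represents S c w t" and d: "word_legal k w d a b"
  shows "represents S c (word_factor d a b w) (term_factor d (c a) (c b) t)"
proof -
  have "a \<in> alph w" if "d \<noteq> 0"
    using d that by (simp add: word_legal_def)
  moreover have "b \<in> alph w \<and> C_defined w a b" if "d \<ge> 5"
    using d that by (auto simp: word_legal_def split: if_splits)
  ultimately show ?thesis
    using w represents_first(2,3)[OF w] represents_last(2,3)[OF w] represents_C[OF w]
    by (auto simp: word_factor_def term_factor_def)
qed

lemma term_legal_if_word_legal:
  assumes w: "represents S c w t" and d: "word_legal k w d a b"
  shows "term_legal k t d (c a) (c b)"
  using d C_defined_iff[OF w] unfolding word_legal_def term_legal_def letters_represents[OF w]
  by auto

text \<open>A move on terms may carry irrelevant numbers that code no letter of the word: both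
  letters for move 0, the second one for moves below 5. These are replaced without affecting the
  factor.\<close>

lemma word_legal_if_term_legal:
  assumes w: "represents S c w t" and d: "term_legal k t d a b"
  obtains a' b' where "word_legal k w d a' b'" "term_factor d a b = term_factor d (c a') (c b')"
proof (cases "d = 0")
  case True
  then have "term_factor d a b = term_factor d (c a') (c b')" for a' b'
    by (simp add: term_factor_def fun_eq_iff)
  then show ?thesis using that True d by (simp add: word_legal_def term_legal_def)
next
  case False
  then obtain a' where a': "a' \<in> alph w" "a = c a'"
    using d by (auto simp: term_legal_def letters_represents[OF w])
  show ?thesis
  proof (cases "d < 5")
    case True
    then have "term_factor d a b = term_factor d (c a') (c a')"
      using a'(2) by (simp add: term_factor_def fun_eq_iff)
    moreover have "word_legal k w d a' a'"
      using a'(1) d True False by (auto simp: word_legal_def term_legal_def split: if_splits)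
    ultimately show ?thesis using that by blast
  next
    case False
    then have "d = 5" "2 \<le> k" "b \<in> letters t" "term_C_defined t a b"
      using d by (auto simp: term_legal_def split: if_splits)
    moreover from this(3) obtain b' where "b' \<in> alph w" "b = c b'"
      by (auto simp: letters_represents[OF w])
    ultimately show ?thesis
      using that[of a' b'] a' C_defined_iff[OF w] by (auto simp: word_legal_def)
  qed
qed

lemma word_legal_cong:
  assumes "word_legal k w d a b" "alph w = alph v"
    "2 \<le> k \<longrightarrow> (\<forall>a\<in>alph w. \<forall>b\<in>alph w. C_defined w a b \<longleftrightarrow> C_defined v a b)"
  shows "word_legal k v d a b"
  using assms by (auto simp: word_legal_def split: if_splits)

text \<open>Away from the final level, the test on terms is exactly the part of
  \<open>eq_kind_Suc\<close> that involves no move; injectivity on \<open>S\<close> recovers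
  equality of alphabets from equality of their images.\<close>

lemma ok_represents:
  assumes "represents S f w t" "represents S f v u" "c \<noteq> 1"
  shows "ok (c, k, t, u) \<longleftrightarrow> alph w = alph v \<and>
    (2 \<le> k \<longrightarrow> (\<forall>a\<in>alph w. \<forall>b\<in>alph w. C_defined w a b \<longleftrightarrow> C_defined v a b))"
proof -
  have "f ` alph w = f ` alph v \<longleftrightarrow> alph w = alph v"
    using assms(1,2) by (intro inj_on_image_eq_iff) (auto simp: represents_def)
  then show ?thesis
    using assms(3) C_defined_iff[OF assms(1)] C_defined_iff[OF assms(2)]
    by (auto simp: letters_represents[OF assms(1)] letters_represents[OF assms(2)])
qed

text \<open>The induction is on \<open>n\<close>, which drops with every move. Level 0 is compatible
  with every \<open>m\<close>, so one state serves all of them.\<close>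

lemma good_imp_eq_kind:
  assumes "good (c, k, t, u)" "represents S f w t" "represents S f v u" "c = 0 \<or> c = Suc m"
  shows "eq_kind k m n w v"
  using assms
proof (induction n arbitrary: c k t u w v m)
  case (Suc n)
  show ?case
  proof (cases m)
    case m: (Suc m')
    with Suc.prems(4) have c: "c \<noteq> 1" by auto
    have ok: "alph w = alph v"
      "2 \<le> k \<longrightarrow> (\<forall>a\<in>alph w. \<forall>b\<in>alph w. C_defined w a b \<longleftrightarrow> C_defined v a b)"
      using good_ok[OF Suc.prems(1)] ok_represents[OF Suc.prems(2,3) c, of k] by blast+
    have "eq_kind (new_kind k d) (if keeps d then m else m') n (word_factor d a b w) (word_factor d a b v)"
      if d: "word_legal k w d a b" for d a b
    proof (rule Suc.IH)
      show "good (if keeps d then c else c - 1, new_kind k d, term_factor d (f a) (f b) t, term_factor d (f a) (f b) u)"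
        using good_step[OF Suc.prems(1), of "(d, f a, f b)"] c term_legal_if_word_legal[OF Suc.prems(2) d] by simp
      show "represents S f (word_factor d a b w) (term_factor d (f a) (f b) t)"
        by (rule represents_word_factor[OF Suc.prems(2) d])
      show "represents S f (word_factor d a b v) (term_factor d (f a) (f b) u)"
        by (rule represents_word_factor[OF Suc.prems(3) word_legal_cong[OF d ok]])
      show "(if keeps d then c else c - 1) = 0 \<or> (if keeps d then c else c - 1) = Suc (if keeps d then m else m')"
        using Suc.prems(4) m by auto
    qed
    then show ?thesis
      unfolding m eq_kind_Suc using ok m by simp
  qed simp
qed simp

lemma step_dead [simp]: "step dead x = dead"
  by (cases x) (simp add: dead_def)

lemma ok_dead [simp]: "ok dead"
  by (simp add: dead_def)

lemma foldl_step_dead [simp]: "foldl step dead ms = dead"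
  by (induction ms) auto

text \<open>The induction is on the sequence of moves; each move consumes one unit of
  \<open>n\<close>, and the premise provides every \<open>n\<close>. At level 0 it also provides
  every \<open>m\<close>, so an infinite level survives the moves that lower
  \<open>m\<close>.\<close>

lemma eq_kind_imp_good:
  assumes "\<And>m n. c = 0 \<or> c = Suc m \<Longrightarrow> eq_kind k m n w v" "represents S f w t" "represents S f v u"
  shows "good (c, k, t, u)"
proof -
  have "ok (foldl step (c, k, t, u) ms)" for ms
    using assms
  proof (induction ms arbitrary: c k t u w v)
    case Nil
    show ?case
    proof (cases "c = 1")
      case False
      \<comment> \<open>The premise is used with positive first index and \<open>n = 1\<close>, the
        smallest indices at which the relations compare anything.\<close>
      then obtain m where "c = 0 \<or> c = Suc (Suc m)" by (metis One_nat_def not0_implies_Suc)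
      from Nil.prems(1)[OF this, of 1] show ?thesis
        using ok_represents[OF Nil.prems(2,3) False] by (simp add: eq_kind_Suc)
    qed simp
  next
    case (Cons x ms)
    obtain d a b where x: "x = (d, a, b)" by (cases x) auto
    show ?case
    proof (cases "c \<noteq> 1 \<and> term_legal k t d a b")
      case True
      then obtain a' b' where d: "word_legal k w d a' b'" "term_factor d a b = term_factor d (f a') (f b')"
        using word_legal_if_term_legal[OF Cons.prems(2)] by blast
      from True obtain m where "c = 0 \<or> c = Suc (Suc m)" by (metis One_nat_def not0_implies_Suc)
      from Cons.prems(1)[OF this, of 1] have
        ok: "alph w = alph v" "2 \<le> k \<longrightarrow> (\<forall>a\<in>alph w. \<forall>b\<in>alph w. C_defined w a b \<longleftrightarrow> C_defined v a b)"
        by (simp_all add: eq_kind_Suc)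
      have "eq_kind (new_kind k d) m n (word_factor d a' b' w) (word_factor d a' b' v)"
        if m: "(if keeps d then c else c - 1) = 0 \<or> (if keeps d then c else c - 1) = Suc m" for m n
      proof (cases m)
        case (Suc m')
        \<comment> \<open>A move that keeps the level needs the premise at \<open>m\<close>, one
          that lowers it needs the premise at \<open>Suc m\<close>; level 0 allows both.\<close>
        have "c = 0 \<or> c = Suc (if keeps d then m else Suc m)"
          using m True by (auto split: if_splits)
        from Cons.prems(1)[OF this, of "Suc n"] show ?thesis
          using eq_kind_step[OF _ d(1), of m' n v] eq_kind_step[OF _ d(1), of m n v] Suc
          by (cases "keeps d") simp_all
      qed simp
      then have "ok (foldl step (if keeps d then c else c - 1, new_kind k d,
          term_factor d (f a') (f b') t, term_factor d (f a') (f b') u) ms)"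
        by (rule Cons.IH[OF _ represents_word_factor[OF Cons.prems(2) d(1)]
            represents_word_factor[OF Cons.prems(3) word_legal_cong[OF d(1) ok]]])
      then show ?thesis using True d(2) x by simp
    next
      case False
      then have "step (c, k, t, u) x = dead" unfolding x by auto
      then show ?thesis by simp
    qed
  qed
  then show ?thesis by (simp add: good_def)
qed

text \<open>Definedness puts \<open>a\<close> to the right of the last \<open>b\<close>, so the left
  cut inside that right factor is made at a letter that occurs, as \<open>factors_closed\<close>
  requires.\<close>

lemma term_C_in_factors:
  assumes "s \<in> factors t" "a \<in> letters s" "b \<in> letters s" "term_C_defined s a b"
  shows "term_C s a b \<in> factors t"
proof -
  have "a \<in> letters (term_Y_right s b)"
    using assms letters_split[of b s] by (auto simp: term_C_defined_def)
  then show ?thesis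
    unfolding term_C_def using factors_closed assms by metis
qed

text \<open>Legality refers to the first term only. Goodness makes \<open>ok\<close> hold at each
  reachable state, which yields the same letters and the same definedness of \<open>C\<close> for
  the second term, so its factors stay in \<open>factors u\<close>.\<close>

lemma finite_reachable:
  assumes "good (c, k, t, u)"
  shows "finite (range (foldl step (c, k, t, u)))"
proof -
  \<comment> \<open>Levels never rise. The bound \<open>Suc k\<close> on kinds allows for the switch
    from 0 to 1.\<close>
  define R where "R = insert dead ({..c} \<times> {..Suc k} \<times> factors t \<times> factors u)"
  have "foldl step (c, k, t, u) ms \<in> R \<and> good (foldl step (c, k, t, u) ms)" for ms
  proof (induction ms rule: rev_induct)
    case Nil
    then show ?case using assms by (simp add: R_def)
  next
    case (snoc x ms)
    obtain d a b where x: "x = (d, a, b)" by (cases x) auto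
    define s where "s = foldl step (c, k, t, u) ms"
    have s: "s \<in> R" "good s" using snoc.IH by (simp_all add: s_def)
    have "step s x \<in> R"
    proof (cases "step s x = dead")
      case False
      with s(1) obtain c' k' t' u' where s': "s = (c', k', t', u')"
        "c' \<le> c" "k' \<le> Suc k" "t' \<in> factors t" "u' \<in> factors u"
        by (auto simp: R_def)
      have d: "c' \<noteq> 1" "term_legal k' t' d a b"
        using False unfolding s'(1) x step.simps by presburger+
      have ok: "letters t' = letters u'"
        "2 \<le> k' \<longrightarrow> (\<forall>a\<in>letters t'. \<forall>b\<in>letters t'. term_C_defined t' a b \<longleftrightarrow> term_C_defined u' a b)"
        using good_ok[OF s(2)] d(1) by (simp_all add: s'(1))
      have "a \<in> letters t'" if "d \<noteq> 0"
        using d(2) that by (simp add: term_legal_def)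
      moreover have "b \<in> letters t' \<and> term_C_defined t' a b \<and> 2 \<le> k'" if "d \<ge> 5"
        using d(2) that by (auto simp: term_legal_def split: if_splits)
      ultimately have "term_factor d a b t' \<in> factors t" "term_factor d a b u' \<in> factors u"
        using s'(4,5) factors_closed[OF s'(4)] factors_closed[OF s'(5)] term_C_in_factors[OF s'(4)]
          term_C_in_factors[OF s'(5)] ok by (auto simp: term_factor_def)
      moreover have "new_kind k' d \<le> Suc k" "(if keeps d then c' else c' - 1) \<le> c"
        using s'(2,3) by (auto simp: new_kind_def)
      ultimately show ?thesis
        using d by (simp add: R_def s'(1) x)
    qed (simp add: R_def)
    then show ?case using s good_step[OF s(2)] by (simp add: s_def)
  qed
  then have "range (foldl step (c, k, t, u)) \<subseteq> R" by auto
  moreover have "finite R" by (simp add: R_def)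
  ultimately show ?thesis by (rule finite_subset)
qed

section \<open>Computing with coded terms\<close>

text \<open>The values of \<open>f\<close> at \<open>0, \<dots>, z - 1\<close> are accumulated in a nested pair \<open>h\<close>, the latest value
  in front.\<close>

lemma course_of_values:
  assumes G: "computable (\<lambda>x. G (pfst x) (pfst (psnd x)) (psnd (psnd x)))"
    and eq: "\<And>z p h. (\<And>k. k < z \<Longrightarrow> pfst ((psnd ^^ (z - 1 - k)) h) = f k p) \<Longrightarrow> f z p = G z h p"
  shows "computable (\<lambda>x. f (pfst x) (psnd x))"
proof -
  define H where "H n p = rec_nat 0 (\<lambda>i h. pair (G i h p) h) n" for n p
  have H: "H (Suc n) p = pair (G n (H n p) p) (H n p)" for n p
    by (simp add: H_def)
  have lookup: "pfst ((psnd ^^ (n - 1 - k)) (H n p)) = f k p" if "k < n" for n k p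
    using that
  proof (induction n arbitrary: k)
    case (Suc n)
    show ?case
    proof (cases "k = n")
      case True
      then show ?thesis using eq[of n "H n p" p] Suc.IH by (simp add: H)
    next
      case False
      then have "Suc n - 1 - k = Suc (n - 1 - k)" "k < n" using Suc.prems by auto
      then show ?thesis using Suc.IH by (simp add: funpow_Suc_right H del: funpow.simps)
    qed
  qed simp
  have "computable (\<lambda>x. G (pfst x) (H (pfst x) (psnd x)) (psnd x))"
    unfolding H_def
    by (intro computable_comp3[OF G] computable_intros)
  moreover have "G z (H z p) p = f z p" for z p
    using eq[of z "H z p" p] lookup by simp
  ultimately show ?thesis by simp
qed

lemma pair_greater: "0 < a \<Longrightarrow> b < pair a b"
proof -
  have "n \<le> triangle n" for n by (induction n) auto
  from this[of "a + b"] show "0 < a \<Longrightarrow> b < pair a b"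
    by (simp add: pair_def prod_encode_def)
qed

lemma pfst_le: "pfst x \<le> x" and psnd_le: "psnd x \<le> x"
  using le_prod_encode_1[of "pfst x" "psnd x"] le_prod_encode_2[of "psnd x" "pfst x"]
  by (simp_all flip: pair_def)

text \<open>The tags of \<open>Cat\<close> and \<open>Power\<close> are positive, which makes codes
  of subterms strictly smaller; with tag 0 this could fail, as \<open>pair 0 0\<close> is 0.\<close>

lemma psnd_less: "0 < pfst x \<Longrightarrow> psnd x < x"
  using pair_greater[of "pfst x" "psnd x"] by simp

text \<open>Recursion along the tags as \<open>decode_term\<close> reads them: below 2 is the base,
  2 is concatenation, and every larger tag counts as \<open>Power\<close>. Besides the recursive
  values, \<open>g2\<close> and \<open>g3\<close> receive the subterm codes, since factors may
  retain whole subterms.\<close>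

lemma computable_term_rec:
  assumes f: "\<And>z p. pfst z < 2 \<Longrightarrow> f z p = g0 z p"
    "\<And>z p. pfst z = 2 \<Longrightarrow> f z p = g2 (pfst (psnd z)) (psnd (psnd z)) (f (pfst (psnd z)) p) (f (psnd (psnd z)) p) p"
    "\<And>z p. 2 < pfst z \<Longrightarrow> f z p = g3 (psnd z) (f (psnd z) p) p"
    and g0: "computable (\<lambda>x. g0 (pfst x) (psnd x))"
    and g2: "computable (\<lambda>x. g2 (pfst x) (pfst (psnd x)) (pfst (psnd (psnd x)))
      (pfst (psnd (psnd (psnd x)))) (psnd (psnd (psnd (psnd x)))))"
    and g3: "computable (\<lambda>x. g3 (pfst x) (pfst (psnd x)) (psnd (psnd x)))"
    and a: "computable a" and b: "computable b"
  shows "computable (\<lambda>x. f (a x) (b x))"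
proof (rule computable_comp2[OF _ a b])
  define at where "at z h k = pfst ((psnd ^^ (z - 1 - k)) h)" for z h k
  have cat: "computable (\<lambda>x. at (z x) (h x) (k x))"
    if "computable z" "computable h" "computable k" for z h k
    unfolding at_def by (intro computable_intros that)
  have g2': "computable (\<lambda>x. g2 (a x) (b x) (c x) (d x) (e x))"
    if "computable a" "computable b" "computable c" "computable d" "computable e" for a b c d e
  proof -
    have "computable (\<lambda>x. pair (a x) (pair (b x) (pair (c x) (pair (d x) (e x)))))"
      by (intro computable_intros that)
    from computable_comp[OF g2 this] show ?thesis by simp
  qed
  define G where "G z h p =
    (if pfst z < 2 then g0 z p
     else if pfst z = 2
     then g2 (pfst (psnd z)) (psnd (psnd z)) (at z h (pfst (psnd z))) (at z h (psnd (psnd z))) p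
     else g3 (psnd z) (at z h (psnd z)) p)" for z h p
  show "computable (\<lambda>x. f (pfst x) (psnd x))"
  proof (rule course_of_values)
    show "computable (\<lambda>x. G (pfst x) (pfst (psnd x)) (psnd (psnd x)))"
      unfolding G_def
      by (intro computable_intros g2' cat computable_comp2[OF g0] computable_comp3[OF g3])
  next
    fix z p h assume IH: "\<And>k. k < z \<Longrightarrow> pfst ((psnd ^^ (z - 1 - k)) h) = f k p"
    have "psnd z < z" if "\<not> pfst z < 2"
      using psnd_less[of z] that by simp
    then have "pfst (psnd z) < z" "psnd (psnd z) < z" "psnd z < z" if "\<not> pfst z < 2"
      using that pfst_le[of "psnd z"] psnd_le[of "psnd z"] by fastforce+
    then show "f z p = G z h p"
      unfolding G_def at_def using f[of z p] IH by auto
  qed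
qed

text \<open>Every number is decoded to some term, since the search below has to terminate on all
  inputs.\<close>

function decode_term :: "nat \<Rightarrow> nat pi_term" where
  "decode_term z =
     (if pfst z = 0 then Eps else if pfst z = 1 then Letter (psnd z)
      else if pfst z = 2 then Cat (decode_term (pfst (psnd z))) (decode_term (psnd (psnd z)))
      else Power (decode_term (psnd z)))"
  by auto
termination
  by (relation "Wellfounded.measure id")
    (auto simp: psnd_less intro: le_less_trans[OF pfst_le psnd_less] le_less_trans[OF psnd_le psnd_less])

declare decode_term.simps [simp del]

lemma code_term_pair [simp]:
  "code_term Eps = pair 0 0" "code_term (Letter a) = pair 1 a"
  "code_term (Cat s t) = pair 2 (pair (code_term s) (code_term t))" "code_term (Power t) = pair 3 (code_term t)"
  by (simp_all add: pair_def)

lemma decode_code_term [simp]: "decode_term (code_term t) = t"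
  by (induction t) (simp_all add: decode_term.simps del: code_term.simps)

declare code_term.simps [simp del]

text \<open>This bound makes quantification over the letters of a coded term a bounded one.\<close>

lemma letters_decode_term: "a \<in> letters (decode_term z) \<Longrightarrow> a \<le> z"
proof (induction z rule: decode_term.induct)
  case (1 z)
  consider "pfst z = 0" | "pfst z = 1" | "pfst z = 2" | "pfst z > 2" by linarith
  then show ?case
  proof cases
    case 3
    then have "a \<le> pfst (psnd z) \<or> a \<le> psnd (psnd z)"
      using 1 by (subst (asm) decode_term.simps[of z]) auto
    then show ?thesis
      using pfst_le[of "psnd z"] psnd_le[of "psnd z"] psnd_le[of z] by linarith
  next
    case 4
    then have "a \<le> psnd z"
      using 1 by (subst (asm) decode_term.simps[of z]) auto
    then show ?thesis
      using psnd_le[of z] by linarith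
  qed (use 1 psnd_le[of z] in \<open>simp_all add: decode_term.simps[of z]\<close>)
qed

lemma decode_term_cases:
  "pfst z < 2 \<Longrightarrow> decode_term z = (if pfst z = 0 then Eps else Letter (psnd z))"
  "pfst z = 2 \<Longrightarrow> decode_term z = Cat (decode_term (pfst (psnd z))) (decode_term (psnd (psnd z)))"
  "2 < pfst z \<Longrightarrow> decode_term z = Power (decode_term (psnd z))"
  by (simp_all add: decode_term.simps[of z])

text \<open>Not the identity: several numbers decode to the same term, for instance all with tag 0
  to \<open>Eps\<close>. Retained subterms in the factors below need their canonical code.\<close>

lemma computable_normalize_code [computable_intros]:
  assumes "computable f"
  shows "computable (\<lambda>x. code_term (decode_term (f x)))"
  by (rule computable_term_rec[where b = "\<lambda>_. 0" and
      ?g0.0 = "\<lambda>z p. if pfst z = 0 then pair 0 0 else pair 1 (psnd z)" and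
      ?g2.0 = "\<lambda>l r fl fr p. pair 2 (pair fl fr)" and ?g3.0 = "\<lambda>l fl p. pair 3 fl"];
    (simp add: decode_term_cases; fail)?; intro computable_intros assms)

lemma decidable_letters [computable_intros]:
  assumes "computable f" "computable g"
  shows "decidable (\<lambda>x. g x \<in> letters (decode_term (f x)))"
  unfolding decidable_def
  by (rule computable_term_rec[where
      ?g0.0 = "\<lambda>z p. if pfst z = 1 \<and> p = psnd z then 1 else 0" and
      ?g2.0 = "\<lambda>l r fl fr p. if fl = 1 \<or> fr = 1 then 1 else 0" and ?g3.0 = "\<lambda>l fl p. fl"];
    (simp add: decode_term_cases; fail)?; intro computable_intros assms)

lemma computable_factors [computable_intros]:
  assumes "computable f" "computable g"
  shows "computable (\<lambda>x. code_term (term_X_left (decode_term (f x)) (g x)))"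
    "computable (\<lambda>x. code_term (term_X_right (decode_term (f x)) (g x)))"
    "computable (\<lambda>x. code_term (term_Y_left (decode_term (f x)) (g x)))"
    "computable (\<lambda>x. code_term (term_Y_right (decode_term (f x)) (g x)))"
proof -
  show "computable (\<lambda>x. code_term (term_X_left (decode_term (f x)) (g x)))"
    by (rule computable_term_rec[where ?g0.0 = "\<lambda>z p. pair 0 0" and
        ?g2.0 = "\<lambda>l r fl fr p. if p \<in> letters (decode_term l) then fl else pair 2 (pair (code_term (decode_term l)) fr)" and
        ?g3.0 = "\<lambda>l fl p. fl"];
      (simp add: decode_term_cases; fail)?; intro computable_intros assms)
  show "computable (\<lambda>x. code_term (term_X_right (decode_term (f x)) (g x)))"
    by (rule computable_term_rec[where ?g0.0 = "\<lambda>z p. pair 0 0" and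
        ?g2.0 = "\<lambda>l r fl fr p. if p \<in> letters (decode_term l) then pair 2 (pair fl (code_term (decode_term r))) else fr" and
        ?g3.0 = "\<lambda>l fl p. pair 2 (pair fl (pair 3 (code_term (decode_term l))))"];
      (simp add: decode_term_cases; fail)?; intro computable_intros assms)
  show "computable (\<lambda>x. code_term (term_Y_left (decode_term (f x)) (g x)))"
    by (rule computable_term_rec[where ?g0.0 = "\<lambda>z p. pair 0 0" and
        ?g2.0 = "\<lambda>l r fl fr p. if p \<in> letters (decode_term r) then pair 2 (pair (code_term (decode_term l)) fr) else fl" and
        ?g3.0 = "\<lambda>l fl p. pair 2 (pair (pair 3 (code_term (decode_term l))) fl)"];
      (simp add: decode_term_cases; fail)?; intro computable_intros assms)
  show "computable (\<lambda>x. code_term (term_Y_right (decode_term (f x)) (g x)))"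
    by (rule computable_term_rec[where ?g0.0 = "\<lambda>z p. pair 0 0" and
        ?g2.0 = "\<lambda>l r fl fr p. if p \<in> letters (decode_term r) then fr else pair 2 (pair fl (code_term (decode_term r)))" and
        ?g3.0 = "\<lambda>l fl p. fl"];
      (simp add: decode_term_cases; fail)?; intro computable_intros assms)
qed

section \<open>Coded states and moves\<close>

definition decode_state :: "nat \<Rightarrow> nat state" where
  "decode_state z = (pfst z, pfst (psnd z), decode_term (pfst (psnd (psnd z))), decode_term (psnd (psnd (psnd z))))"

fun code_state :: "nat state \<Rightarrow> nat" where
  "code_state (c, k, t, u) = pair c (pair k (pair (code_term t) (code_term u)))"

lemma decode_code_state [simp]: "decode_state (code_state s) = s"
  by (cases s) (simp add: decode_state_def)

definition decode_move :: "nat \<Rightarrow> nat \<times> nat \<times> nat" where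
  "decode_move x = (pfst x, pfst (psnd x), psnd (psnd x))"

lemma decode_move_pair [simp]: "decode_move (pair d (pair a b)) = (d, a, b)"
  by (simp add: decode_move_def)

lemma decidable_term_C_defined [computable_intros]:
  assumes "computable f" "computable g" "computable h"
  shows "decidable (\<lambda>x. term_C_defined (decode_term (f x)) (g x) (h x))"
proof -
  \<comment> \<open>The detour through \<open>decode_term\<close> and \<open>code_term\<close> gives
    the left factor the form of a decoded number, which is the form that the rule for letters
    handles.\<close>
  have "decidable (\<lambda>x. g x \<noteq> h x \<and> g x \<notin> letters (decode_term (code_term (term_Y_left (decode_term (f x)) (h x)))))"
    by (intro computable_intros assms)
  then show ?thesis by (simp add: term_C_defined_def)
qed

lemma computable_term_factor [computable_intros]:
  assumes "computable d" "computable a" "computable b" "computable f"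
  shows "computable (\<lambda>x. code_term (term_factor (d x) (a x) (b x) (decode_term (f x))))"
proof -
  have "computable (\<lambda>x. if d x = 0 then code_term (decode_term (f x))
      else if d x = 1 then code_term (term_X_left (decode_term (f x)) (a x))
      else if d x = 2 then code_term (term_X_right (decode_term (f x)) (a x))
      else if d x = 3 then code_term (term_Y_left (decode_term (f x)) (a x))
      else if d x = 4 then code_term (term_Y_right (decode_term (f x)) (a x))
      else code_term (term_X_left (decode_term (code_term (term_Y_right (decode_term (f x)) (b x)))) (a x)))"
    by (intro computable_intros assms)
  moreover have "(if d = 0 then code_term t else if d = 1 then code_term (term_X_left t a)
      else if d = 2 then code_term (term_X_right t a) else if d = 3 then code_term (term_Y_left t a)
      else if d = 4 then code_term (term_Y_right t a) else code_term (term_X_left (decode_term (code_term (term_Y_right t b))) a)) =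
      code_term (term_factor d a b t)" for d a b t
    by (simp add: term_factor_def term_C_def)
  ultimately show ?thesis by (simp only:)
qed

lemma decidable_term_legal [computable_intros]:
  assumes "computable k" "computable f" "computable d" "computable a" "computable b"
  shows "decidable (\<lambda>x. term_legal (k x) (decode_term (f x)) (d x) (a x) (b x))"
proof -
  have term_legal_iff: "term_legal k t d a b \<longleftrightarrow> d = 0 \<and> k < 2 \<or> d \<noteq> 0 \<and> a \<in> letters t \<and>
    (k = 0 \<and> (d = 1 \<or> d = 2) \<or> k = 1 \<and> (d = 3 \<or> d = 4) \<or>
     \<not> k < 2 \<and> (d < 5 \<or> d = 5 \<and> b \<in> letters t \<and> term_C_defined t a b))" for k t d and a b :: nat
    by (auto simp: term_legal_def)
  show ?thesis
    unfolding term_legal_iff by (intro computable_intros assms)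
qed

definition code_step :: "nat \<Rightarrow> nat \<Rightarrow> nat" where
  "code_step z x = code_state (step (decode_state z) (decode_move x))"

lemma decode_code_step [simp]: "decode_state (code_step z x) = step (decode_state z) (decode_move x)"
  by (simp add: code_step_def)

lemma computable_code_step [computable_intros]:
  assumes "computable f" "computable g"
  shows "computable (\<lambda>x. code_step (f x) (g x))"
proof (rule computable_comp2[OF _ assms])
  have code_step_eq: "code_step z x =
    (let d = pfst x; a = pfst (psnd x); b = psnd (psnd x); c = pfst z; k = pfst (psnd z);
         t = pfst (psnd (psnd z)); u = psnd (psnd (psnd z))
     in if c \<noteq> 1 \<and> term_legal k (decode_term t) d a b
        then pair (if d = 2 \<or> d = 3 then c else c - 1)
          (pair (if 2 \<le> k \<or> d = 2 \<or> d = 3 then k else 1 - k)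
            (pair (code_term (term_factor d a b (decode_term t))) (code_term (term_factor d a b (decode_term u)))))
        else code_state dead)" for z x
    by (simp add: code_step_def decode_state_def decode_move_def new_kind_def keeps_def Let_def)
  show "computable (\<lambda>p. code_step (pfst p) (psnd p))"
    unfolding code_step_eq Let_def by (intro computable_intros)
qed

lemma decidable_ok [computable_intros]:
  assumes "computable f"
  shows "decidable (\<lambda>x. ok (decode_state (f x)))"
proof (rule decidable_comp[OF _ assms])
  have ok_iff: "ok (decode_state z) \<longleftrightarrow> pfst z = 1 \<or>
    (\<forall>a\<le>z. a \<in> letters (decode_term (pfst (psnd (psnd z)))) \<longleftrightarrow> a \<in> letters (decode_term (psnd (psnd (psnd z))))) \<and>
    (2 \<le> pfst (psnd z) \<longrightarrow> (\<forall>a\<le>z. \<forall>b\<le>z.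
      a \<in> letters (decode_term (pfst (psnd (psnd z)))) \<longrightarrow> b \<in> letters (decode_term (pfst (psnd (psnd z)))) \<longrightarrow>
      (term_C_defined (decode_term (pfst (psnd (psnd z)))) a b \<longleftrightarrow> term_C_defined (decode_term (psnd (psnd (psnd z)))) a b)))"
    for z
  proof -
    have "a \<le> z" if "a \<in> letters (decode_term (pfst (psnd (psnd z)))) \<or> a \<in> letters (decode_term (psnd (psnd (psnd z))))" for a
      using that letters_decode_term[of a] pfst_le[of "psnd (psnd z)"] psnd_le[of "psnd (psnd z)"]
        psnd_le[of "psnd z"] psnd_le[of z] by (meson le_trans)
    then show ?thesis unfolding decode_state_def ok.simps set_eq_iff by blast
  qed
  show "decidable (\<lambda>z. ok (decode_state z))"
    unfolding ok_iff by (intro computable_intros)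
qed

section \<open>Witnesses for equivalence and for inequivalence\<close>

lemma decidable_set_decode [computable_intros]:
  assumes "computable f" "computable g"
  shows "decidable (\<lambda>x. f x \<in> set_decode (g x))"
proof -
  have "computable (\<lambda>x. LEAST k. x < Suc (Suc (k + k)))"
  proof (rule computable_Least)
    show "\<exists>k. x < Suc (Suc (k + k))" for x :: nat
      by (intro exI[of _ x]) auto
  qed (intro computable_intros)
  moreover have "(LEAST k. x < Suc (Suc (k + k))) = x div 2" for x :: nat
    by (rule Least_equality) auto
  ultimately have "computable (\<lambda>x. x div 2)" by simp
  then have half: "computable (\<lambda>x. f x div 2)" if "computable f" for f
    using that by (rule computable_comp)
  \<comment> \<open>Repeated halving moves the wanted binary digit to the lowest place; it is set
    iff the number is odd, that is, differs from twice its half.\<close>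
  then have "decidable (\<lambda>x. ((\<lambda>y. y div 2) ^^ f x) (g x) div 2 + ((\<lambda>y. y div 2) ^^ f x) (g x) div 2
      \<noteq> ((\<lambda>y. y div 2) ^^ f x) (g x))"
    by (intro computable_intros half assms)+
  moreover have "n \<in> set_decode y \<longleftrightarrow> ((\<lambda>y. y div 2) ^^ n) y div 2 + ((\<lambda>y. y div 2) ^^ n) y div 2
      \<noteq> ((\<lambda>y. y div 2) ^^ n) y" for n y
  proof (induction n arbitrary: y)
    case 0
    show ?case by (simp add: set_decode_0) presburger
  next
    case (Suc n)
    then show ?case by (simp add: set_decode_Suc funpow_Suc_right del: funpow.simps)
  qed
  ultimately show ?thesis by simp
qed

text \<open>The binary digits of \<open>y\<close> code a finite set of state codes containing the
  canonical code of the start. It suffices to let states range up to \<open>y\<close>, move types up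
  to 5 and letters up to the state code, which makes closedness decidable.\<close>

definition closed_witness :: "nat \<Rightarrow> nat \<Rightarrow> bool" where
  "closed_witness s y \<longleftrightarrow> code_state (decode_state s) \<in> set_decode y \<and> code_state dead \<in> set_decode y \<and>
     (\<forall>z\<le>y. z \<in> set_decode y \<longrightarrow> ok (decode_state z) \<and>
        (\<forall>d\<le>5. \<forall>a\<le>z. \<forall>b\<le>z. code_step z (pair d (pair a b)) \<in> set_decode y))"

text \<open>The second component is a stack of coded moves. Unpairing never fails, so the stack has
  no end marker and the number of moves is given separately.\<close>

definition run_moves :: "nat \<Rightarrow> nat" where
  "run_moves p = pair (code_step (pfst p) (pfst (psnd p))) (psnd (psnd p))"

definition path_witness :: "nat \<Rightarrow> nat \<Rightarrow> bool" where
  "path_witness s y \<longleftrightarrow> \<not> ok (decode_state (pfst ((run_moves ^^ pfst y) (pair s (psnd y)))))"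

lemma letters_decode_state: "a \<in> letters (decode_term (pfst (psnd (psnd z)))) \<Longrightarrow> a \<le> z"
  using letters_decode_term[of a] pfst_le[of "psnd (psnd z)"] psnd_le[of "psnd z"] psnd_le[of z] by (meson le_trans)

text \<open>The letters that a legal move uses occur in the first term and hence are at most
  \<open>z\<close>; letters that it does not use are set to 0.\<close>

lemma bounded_move:
  obtains "step (decode_state z) (d, a, b) = dead"
  | d' a' b' where "d' \<le> 5" "a' \<le> z" "b' \<le> z" "step (decode_state z) (d, a, b) = step (decode_state z) (d', a', b')"
proof -
  define t where "t = decode_term (pfst (psnd (psnd z)))"
  show ?thesis
  proof (cases "term_legal (pfst (psnd z)) t d a b")
    case True
    define a' b' where "a' = (if d = 0 then 0 else a)" and "b' = (if d < 5 then 0 else b)"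
    have "d \<le> 5" using True by (auto simp: term_legal_def split: if_splits)
    moreover have "a' \<le> z" "b' \<le> z"
      using True letters_decode_state[of _ z] \<open>d \<le> 5\<close>
      by (auto simp: a'_def b'_def term_legal_def t_def split: if_splits)
    moreover have "term_legal (pfst (psnd z)) t d a' b'" "term_factor d a b = term_factor d a' b'"
      using True \<open>d \<le> 5\<close> by (auto simp: a'_def b'_def term_legal_def term_factor_def fun_eq_iff split: if_splits)
    ultimately show ?thesis
      using that(2)[of d a' b'] True by (simp add: decode_state_def t_def)
  next
    case False
    then show ?thesis using that(1) by (simp add: decode_state_def t_def)
  qed
qed

lemma closed_witness_good:
  assumes "closed_witness s y"
  shows "good (decode_state s)"
proof -
  note W = assms[unfolded closed_witness_def]
  have bound: "z \<le> y" if "z \<in> set_decode y" for z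
  proof -
    \<comment> \<open>A digit set at place \<open>z\<close> forces the number to be at least
      \<open>2 ^ z\<close>, so all members lie in the range of the bounded quantifier.\<close>
    have "(2::nat) ^ z \<le> y"
      using that by (metis set_decode_def div_less even_zero mem_Collect_eq not_less)
    then show ?thesis
      using less_exp[of z] by linarith
  qed
  have "ok (foldl step (decode_state z) ms)" if "z \<in> set_decode y" for z ms
    using that
  proof (induction ms arbitrary: z)
    case Nil
    then show ?case using W bound by simp
  next
    case (Cons x ms)
    obtain d a b where x: "x = (d, a, b)" by (cases x) auto
    show ?case
      unfolding x
    proof (rule bounded_move[of z d a b])
      fix d' a' b' assume m: "d' \<le> 5" "a' \<le> z" "b' \<le> z"
        "step (decode_state z) (d, a, b) = step (decode_state z) (d', a', b')"
      then have "code_step z (pair d' (pair a' b')) \<in> set_decode y"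
        using W bound[OF Cons.prems] Cons.prems by blast
      from Cons.IH[OF this] show "ok (foldl step (decode_state z) ((d, a, b) # ms))"
        using m(4) by simp
    qed simp
  qed
  from this[of "code_state (decode_state s)"] show ?thesis
    using W unfolding good_def by simp
qed

text \<open>The witness consists of the canonical codes of all reachable states together with
  \<open>dead\<close>. It is closed under all moves, in particular under the bounded ones.\<close>

lemma ex_closed_witness:
  assumes "good (decode_state s)"
  shows "\<exists>y. closed_witness s y"
proof -
  define R where "R = insert dead (range (foldl step (decode_state s)))"
  obtain c k t u where "decode_state s = (c, k, t, u)" by (cases "decode_state s") auto
  then have "finite (code_state ` R)"
    using finite_reachable[of c k t u] assms by (simp add: R_def)
  then have D: "set_decode (set_encode (code_state ` R)) = code_state ` R"
    by (rule set_encode_inverse)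
  have R: "ok q \<and> step q x \<in> R" if "q \<in> R" for q x
  proof -
    from that consider "q = dead" | ms where "q = foldl step (decode_state s) ms"
      by (auto simp: R_def)
    then show ?thesis
    proof cases
      case (2 ms)
      then have "step q x = foldl step (decode_state s) (ms @ [x])" by simp
      then have "step q x \<in> R" unfolding R_def by blast
      then show ?thesis using assms 2 by (simp add: good_def)
    qed (simp add: R_def)
  qed
  moreover have "decode_state s \<in> R"
    unfolding R_def by (metis foldl_Nil insertI2 rangeI)
  moreover have "dead \<in> R"
    by (simp add: R_def)
  moreover have "ok (decode_state z)" "code_step z x \<in> code_state ` R" if "z \<in> code_state ` R" for z x
  proof -
    from that obtain q where q: "z = code_state q" "q \<in> R" by blast
    show "ok (decode_state z)" "code_step z x \<in> code_state ` R"
      unfolding code_step_def q(1) decode_code_state using R[OF q(2)] by blast+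
  qed
  ultimately have "closed_witness s (set_encode (code_state ` R))"
    unfolding closed_witness_def D by blast
  then show ?thesis ..
qed

lemma run_moves:
  "\<exists>w. decode_state (pfst ((run_moves ^^ length ms) (pair s w))) = foldl step (decode_state s) ms"
proof (induction ms arbitrary: s)
  case (Cons x ms)
  obtain d a b where x: "x = (d, a, b)" by (cases x) auto
  define s' where "s' = code_step s (pair d (pair a b))"
  obtain w where "decode_state (pfst ((run_moves ^^ length ms) (pair s' w))) = foldl step (decode_state s') ms"
    using Cons.IH by blast
  moreover have "run_moves (pair s (pair (pair d (pair a b)) w)) = pair s' w"
    by (simp add: run_moves_def s'_def)
  ultimately show ?case
    by (intro exI[of _ "pair (pair d (pair a b)) w"])
      (simp add: funpow_Suc_right x s'_def del: funpow.simps)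
qed simp

text \<open>Every number decodes to a move, so any stack describes a genuine path. Hence a path
  witness really refutes goodness.\<close>

lemma run_moves_reachable:
  "\<exists>ms. decode_state (pfst ((run_moves ^^ n) p)) = foldl step (decode_state (pfst p)) ms"
proof (induction n)
  case 0
  show ?case by (intro exI[of _ "[]"]) simp
next
  case (Suc n)
  then obtain ms where ms: "decode_state (pfst ((run_moves ^^ n) p)) = foldl step (decode_state (pfst p)) ms" ..
  define q where "q = (run_moves ^^ n) p"
  have "decode_state (pfst (run_moves q)) = step (decode_state (pfst q)) (decode_move (pfst (psnd q)))"
    by (simp add: run_moves_def)
  then show ?case
    using ms by (intro exI[of _ "ms @ [decode_move (pfst (psnd q))]"]) (simp add: q_def)
qed

lemma decidable_good:
  assumes "computable f"
  shows "decidable (\<lambda>x. good (decode_state (f x)))"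
proof (rule decidable_comp[OF _ assms])
  have "decidable (\<lambda>p. closed_witness (pfst p) (psnd p))"
    unfolding closed_witness_def decode_state_def code_state.simps
    by (intro computable_intros decidable_ok[unfolded decode_state_def])
  note cw = decidable_comp2[OF this]
  have run: "computable run_moves"
    unfolding run_moves_def[abs_def] by (intro computable_intros)
  have pw: "decidable (\<lambda>x. path_witness (f x) (g x))" if "computable f" "computable g" for f g
    unfolding path_witness_def by (intro computable_intros run that)
  have not_good: "\<not> good (decode_state s)" if "path_witness s y" for s y
    using that run_moves_reachable[of "pfst y" "pair s (psnd y)"]
    unfolding path_witness_def good_def by auto
  have ex: "\<exists>y. closed_witness s y \<or> path_witness s y" for s
  proof (cases "good (decode_state s)")
    case False
    then obtain ms where "\<not> ok (foldl step (decode_state s) ms)" unfolding good_def by blast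
    moreover obtain w where "decode_state (pfst ((run_moves ^^ length ms) (pair s w))) = foldl step (decode_state s) ms"
      using run_moves by blast
    ultimately have "path_witness s (pair (length ms) w)"
      by (simp add: path_witness_def)
    then show ?thesis by blast
  qed (use ex_closed_witness in blast)
  have "computable (\<lambda>s. LEAST y. closed_witness s y \<or> path_witness s y)"
    by (rule computable_Least) (intro computable_intros cw pw ex)+
  \<comment> \<open>The two kinds of witness exclude each other, so the kind of the least one gives
    the answer.\<close>
  then have "decidable (\<lambda>s. closed_witness s (LEAST y. closed_witness s y \<or> path_witness s y))"
    by (intro cw computable_intros)
  moreover have "closed_witness s (LEAST y. closed_witness s y \<or> path_witness s y) \<longleftrightarrow> good (decode_state s)" for s
    using LeastI_ex[OF ex[of s]] closed_witness_good not_good by blast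
  ultimately show "decidable (\<lambda>s. good (decode_state s))" by simp
qed

section \<open>From goodness to the two decision problems\<close>

lemma eq_kind_iff_good:
  assumes f: "inj_on f \<Sigma>" and \<alpha>: "letters \<alpha> \<subseteq> \<Sigma>" and \<beta>: "letters \<beta> \<subseteq> \<Sigma>"
  shows "(\<forall>m n. c = 0 \<or> c = Suc m \<longrightarrow>
      eq_kind k m n (interp omega_plus_omega_star \<alpha>) (interp omega_plus_omega_star \<beta>)) \<longleftrightarrow>
    good (c, k, map_pi_term f \<alpha>, map_pi_term f \<beta>)"
proof -
  have "represents \<Sigma> f (interp omega_plus_omega_star t) (map_pi_term f t)" if "letters t \<subseteq> \<Sigma>" for t
    using that f letters_spells[OF spells_interp[of t]] spells_map[OF spells_interp[of t], of f] Linear_order_interp[of t]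
    by (simp add: represents_def alph_def)
  note repr = this[OF \<alpha>] this[OF \<beta>]
  show ?thesis
  proof
    assume "\<forall>m n. c = 0 \<or> c = Suc m \<longrightarrow>
      eq_kind k m n (interp omega_plus_omega_star \<alpha>) (interp omega_plus_omega_star \<beta>)"
    then show "good (c, k, map_pi_term f \<alpha>, map_pi_term f \<beta>)"
      by (intro eq_kind_imp_good[OF _ repr]) blast
  next
    assume "good (c, k, map_pi_term f \<alpha>, map_pi_term f \<beta>)"
    then show "\<forall>m n. c = 0 \<or> c = Suc m \<longrightarrow>
      eq_kind k m n (interp omega_plus_omega_star \<alpha>) (interp omega_plus_omega_star \<beta>)"
      using good_imp_eq_kind[OF _ repr] by blast
  qed
qed

lemma decidable_onI:
  assumes "computes k a" "decidable P"
    and "\<And>x. x \<in> I \<Longrightarrow> length (code x) = k \<and> (P (a (code x)) \<longleftrightarrow> Q x)"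
  shows "decidable_on k code I Q"
proof -
  have "computes k (\<lambda>xs. if P (a xs) then 1 else 0)"
    using computes_computable[OF _ assms(1)] assms(2) unfolding decidable_def by blast
  then obtain F where "total_recursive k F" "\<And>xs. length xs = k \<Longrightarrow> F xs = (if P (a xs) then 1 else 0)"
    unfolding computes_def by blast
  then show ?thesis
    unfolding decidable_on_def using assms(3) by (intro exI[of _ F]) auto
qed

lemma all_eq_kind_iff: "(\<forall>n\<ge>1. eq_kind k m n w v) \<longleftrightarrow> (\<forall>n. eq_kind k m n w v)"
  by (metis One_nat_def Suc_leI eq_kind_0(2) neq0_conv)

text \<open>\<open>XY\<close> has code 2, which a state would read as \<open>WI\<close>, so it has
  to be split into kinds 0 and 1. The code 3 of \<open>WI\<close> may be used as it is.\<close>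

lemma equiv_m_iff:
  "equiv_m Z m w v \<longleftrightarrow>
     (if code_kind Z = 2 then (\<forall>n. eq_kind 0 m n w v) \<and> (\<forall>n. eq_kind 1 m n w v)
      else \<forall>n. eq_kind (code_kind Z) m n w v)"
proof -
  have "equiv_mn Z m n w v \<longleftrightarrow>
     (if code_kind Z = 2 then eq_kind 0 m n w v \<and> eq_kind 1 m n w v else eq_kind (code_kind Z) m n w v)" for n
    by (cases Z) (simp_all add: eq_kind_def)
  then show ?thesis
    unfolding equiv_m_def all_eq_kind_iff[symmetric] by auto
qed

theorem theorem5:
  "decidable_on 4
       (\<lambda>(m, Z, \<Sigma>, c, \<alpha>, \<beta>).
          [m, code_kind Z, code_term (map_pi_term c \<alpha>), code_term (map_pi_term c \<beta>)])
       {(m :: nat, Z :: kind, \<Sigma> :: 'a set, c, \<alpha>, \<beta>). (\<Sigma>, c, \<alpha>, \<beta>) \<in> term_pairs}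
       (\<lambda>(m, Z, \<Sigma>, c, \<alpha>, \<beta>).
          equiv_m Z m (interp omega_plus_omega_star \<alpha>) (interp omega_plus_omega_star \<beta>))
     \<and>
     decidable_on 2
       (\<lambda>(\<Sigma>, c, \<alpha>, \<beta>). [code_term (map_pi_term c \<alpha>), code_term (map_pi_term c \<beta>)])
       (term_pairs :: ('a set \<times> _) set)
       (\<lambda>(\<Sigma>, c, \<alpha>, \<beta>).
          \<forall>m\<ge>1. equiv_m XY m (interp omega_plus_omega_star \<alpha>) (interp omega_plus_omega_star \<beta>))"
proof
  define P where "P x \<longleftrightarrow> good (decode_state x)" for x
  have P: "decidable (\<lambda>x. P (f x))" if "computable f" for f
    unfolding P_def using that by (rule decidable_good)
  have P_code: "P (pair c (pair k (pair (code_term (map_pi_term f \<alpha>)) (code_term (map_pi_term f \<beta>))))) \<longleftrightarrow>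
      (\<forall>m n. c = 0 \<or> c = Suc m \<longrightarrow>
        eq_kind k m n (interp omega_plus_omega_star \<alpha>) (interp omega_plus_omega_star \<beta>))"
    if "(\<Sigma>, f, \<alpha>, \<beta>) \<in> term_pairs" for \<Sigma> :: "'a set" and f \<alpha> \<beta> c k
    using that eq_kind_iff_good[of f \<Sigma> \<alpha> \<beta> c k] by (simp add: term_pairs_def P_def decode_state_def)
  \<comment> \<open>The input is \<open>m\<close>, the kind and the two terms, paired in this order;
    the level \<open>Suc m\<close> stands for the finite index \<open>m\<close>.\<close>
  define Q where "Q x \<longleftrightarrow>
    (pfst (psnd x) = 2 \<longrightarrow> P (pair (Suc (pfst x)) (pair 0 (psnd (psnd x)))) \<and>
       P (pair (Suc (pfst x)) (pair 1 (psnd (psnd x))))) \<and>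
    (pfst (psnd x) \<noteq> 2 \<longrightarrow> P (pair (Suc (pfst x)) (psnd x)))" for x
  show "decidable_on 4
       (\<lambda>(m, Z, \<Sigma>, c, \<alpha>, \<beta>).
          [m, code_kind Z, code_term (map_pi_term c \<alpha>), code_term (map_pi_term c \<beta>)])
       {(m :: nat, Z :: kind, \<Sigma> :: 'a set, c, \<alpha>, \<beta>). (\<Sigma>, c, \<alpha>, \<beta>) \<in> term_pairs}
       (\<lambda>(m, Z, \<Sigma>, c, \<alpha>, \<beta>).
          equiv_m Z m (interp omega_plus_omega_star \<alpha>) (interp omega_plus_omega_star \<beta>))"
  proof (rule decidable_onI)
    show "computes 4 (\<lambda>xs. pair (xs ! 0) (pair (xs ! 1) (pair (xs ! 2) (xs ! 3))))"
      by (intro computes_pair computes_proj) auto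
    show "decidable Q"
      unfolding Q_def[abs_def] by (intro computable_intros P)
  qed (auto simp: Q_def P_code equiv_m_iff numeral_3_eq_3 simp del: code_term_pair)
  \<comment> \<open>Level 0 is the infinite index; kinds 0 and 1 together make up
    \<open>XY\<close>.\<close>
  define R where "R x \<longleftrightarrow> P (pair 0 (pair 0 x)) \<and> P (pair 0 (pair 1 x))" for x
  show "decidable_on 2
       (\<lambda>(\<Sigma>, c, \<alpha>, \<beta>). [code_term (map_pi_term c \<alpha>), code_term (map_pi_term c \<beta>)])
       (term_pairs :: ('a set \<times> _) set)
       (\<lambda>(\<Sigma>, c, \<alpha>, \<beta>).
          \<forall>m\<ge>1. equiv_m XY m (interp omega_plus_omega_star \<alpha>) (interp omega_plus_omega_star \<beta>))"
  proof (rule decidable_onI)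
    show "computes 2 (\<lambda>xs. pair (xs ! 0) (xs ! 1))"
      by (intro computes_pair computes_proj) auto
    show "decidable R"
      unfolding R_def[abs_def] by (intro computable_intros P)
    have "(\<forall>m\<ge>1. equiv_m XY m w v) \<longleftrightarrow> (\<forall>m n. eq_kind 0 m n w v) \<and> (\<forall>m n. eq_kind 1 m n w v)"
      for w v :: "(int pos, 'a) gword"
    proof -
      \<comment> \<open>The index \<open>m = 0\<close>, which level 0 includes, adds nothing because
        the relations are trivial there.\<close>
      have "eq_kind k m n w v" if "\<forall>m\<ge>1. \<forall>n. eq_kind k m n w v" for k m n
        using that by (cases m) auto
      then show ?thesis unfolding equiv_m_iff by auto
    qed
    then show "x \<in> term_pairs \<Longrightarrow>
        length (case x of (\<Sigma>, c, \<alpha>, \<beta>) \<Rightarrow> [code_term (map_pi_term c \<alpha>), code_term (map_pi_term c \<beta>)]) = 2 \<and>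
        (R (pair ((case x of (\<Sigma>, c, \<alpha>, \<beta>) \<Rightarrow> [code_term (map_pi_term c \<alpha>), code_term (map_pi_term c \<beta>)]) ! 0)
           ((case x of (\<Sigma>, c, \<alpha>, \<beta>) \<Rightarrow> [code_term (map_pi_term c \<alpha>), code_term (map_pi_term c \<beta>)]) ! 1)) \<longleftrightarrow>
         (case x of (\<Sigma>, c, \<alpha>, \<beta>) \<Rightarrow>
          \<forall>m\<ge>1. equiv_m XY m (interp omega_plus_omega_star \<alpha>) (interp omega_plus_omega_star \<beta>)))"
      for x :: "'a set \<times> ('a \<Rightarrow> nat) \<times> 'a pi_term \<times> 'a pi_term"
      by (cases x) (auto simp: R_def P_code)
  qed
qed

end
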